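(* Let $Z$ be a geodesic metric space satisfying the thick bigon property and let $\mathscr{L}H=L(H)\rtimes H$ be a finitely generated halo product with $\mathscr{L}$ full and $L(H)$ locally finite. Every coarse embedding $\rho:Z\to\mathscr{L}H$ has its image contained in a neighbourhood of an $H$-coset $cH$ ($c\in L(H)$). Moreover, the size of this neighbourhood only depends on $Z$, $\mathscr{L}H$, and the parameters of $\rho$.
   Context: Halo products: let $H$ be a group. A halo of groups $\mathscr{L}$ over $H$ is the data, for every subset $S \subset H$, of a group $L(S)$ such that: (i) if $R \subset S \subset H$ then $L(R) \leq L(S)$; (ii) $L(\emptyset)=\{1\}$ and $L(H)=\langle L(S) : S \subset H \text{ finite}\rangle$; (iii) $L(R)\cap L(S)=L(R\cap S)$ for all $R,S\subset H$. Given a morphism $\alpha : H \to \mathrm{Aut}(L(H))$ with $\alpha(h)(L(S))=L(hS)$ for all $h\in H$, $S\subset H$, the halo product $\mathscr{L}H$ is the semidirect product $L(H)\rtimes_\alpha H$. If $\mathscr{L}H$ is finitely generated, then so is $H$, and both are endowed with word metrics coming from finite generating sets. Full: a halo of groups $\mathscr{L}$ over a metric space $X$ is full if there exists $K\ge 0$ such that, for all subsets $R,S,T,U\subset X$, if $d(R,S),d(R,T),d(R,U),d(S,T)\ge K$ then $L(R\cup S)L(U)\cap L(R\cup T)\subset L(R)L(T)$ (products of subsets of $L(X)$). Coarse embedding: a map $f:X\to Y$ between metric spaces for which there are functions $\sigma_-,\sigma_+:[0,\infty)\to[0,\infty)$ tending to $+\infty$ (its parameters) with $\sigma_-(d(x,y))\le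 d(f(x),f(y))\le\sigma_+(d(x,y))$ for all $x,y\in X$. Coarse homotopy: for $C\ge 0$, two paths $\alpha,\beta$ in a metric space with the same endpoints are $C$-coarsely homotopic if there is a sequence of paths $\gamma_0=\alpha,\gamma_1,\dots,\gamma_n=\beta$ such that each $\gamma_{i+1}$ is obtained from $\gamma_i$ by replacing a subpath $\zeta$ with a path $\xi$ with the same endpoints satisfying $\mathrm{diam}(\zeta\cup\xi)\le C$. Thick bigon property: a metric space $X$ has it if there exists $C\ge 0$ such that, for every $R\ge 0$, the following holds for some $L\ge 0$: any two points $x,y\in X$ are connected by some path $\gamma_1$ such that, for every $p\in\gamma_1$ with $d(x,p),d(y,p)\ge L$, there is a path $\gamma_2$ between $x$ and $y$ that is $C$-coarsely homotopic to $\gamma_1$ and avoids the ball $B(p,R)$.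
   Formalization: The upper parameter σ₊ of the coarse embedding is additionally required to be bounded on bounded intervals (as any nondecreasing function is); with arbitrary σ₊ the claim fails, e.g. for Z=[0,1] and the lamplighter group over the integers. *)

theory Defs
  imports
    "HOL-Analysis.Analysis"
    "HOL-Algebra.Bij"
    "HOL-Algebra.Generated_Groups"
begin

section \<open>Groups: word metrics, local finiteness, semidirect products\<close>

definition finite_generating_set :: "('g, 'm) monoid_scheme \<Rightarrow> 'g set \<Rightarrow> bool" where
  "finite_generating_set G S \<longleftrightarrow> finite S \<and> S \<subseteq> carrier G \<and> generate G S = carrier G"

definition word_length :: "('g, 'm) monoid_scheme \<Rightarrow> 'g set \<Rightarrow> 'g \<Rightarrow> nat" where
  "word_length G S g =
     (LEAST n. \<exists>ws. length ws = n \<and> set ws \<subseteq> S \<union> m_inv G ` S \<and>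
                    foldr (\<lambda>x y. x \<otimes>\<^bsub>G\<^esub> y) ws \<one>\<^bsub>G\<^esub> = g)"

text \<open>The left-invariant word metric. This is the convention under which the action
  of \<open>H\<close> on the index sets of a halo, \<open>S \<mapsto> hS\<close>, is isometric.\<close>
definition word_metric :: "('g, 'm) monoid_scheme \<Rightarrow> 'g set \<Rightarrow> 'g \<Rightarrow> 'g \<Rightarrow> real" where
  "word_metric G S g h = real (word_length G S (inv\<^bsub>G\<^esub> g \<otimes>\<^bsub>G\<^esub> h))"

definition locally_finite_group :: "('g, 'm) monoid_scheme \<Rightarrow> bool" where
  "locally_finite_group G \<longleftrightarrow>
     (\<forall>F. finite F \<and> F \<subseteq> carrier G \<longrightarrow> finite (generate G F))"

definition semidirect_product ::
  "('a, 'n) monoid_scheme \<Rightarrow> ('h, 'm) monoid_scheme \<Rightarrow> ('h \<Rightarrow> 'a \<Rightarrow> 'a) \<Rightarrow> ('a \<times> 'h) monoid" where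
  "semidirect_product A H \<alpha> =
     \<lparr>carrier = carrier A \<times> carrier H,
      monoid.mult = (\<lambda>(a, h) (b, k). (a \<otimes>\<^bsub>A\<^esub> \<alpha> h b, h \<otimes>\<^bsub>H\<^esub> k)),
      one = (\<one>\<^bsub>A\<^esub>, \<one>\<^bsub>H\<^esub>)\<rparr>"


section \<open>Halos of groups\<close>

text \<open>Since \<open>L(S) \<le> L(X)\<close> for all \<open>S\<close>, a halo over \<open>X\<close> is encoded by the single group
  \<open>A = L(X)\<close> together with the carriers \<open>L S\<close> of the groups \<open>L(S)\<close>, whose operation is
  that of \<open>A\<close>. The values of \<open>L\<close> on sets not contained in \<open>X\<close> are irrelevant.\<close>
locale halo_of_groups = group A
  for X :: "'x set" and A :: "('a, 'n) monoid_scheme" and L :: "'x set \<Rightarrow> 'a set" +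
  assumes L_top: "L X = carrier A"
    and L_subgroup: "R \<subseteq> S \<Longrightarrow> S \<subseteq> X \<Longrightarrow> subgroup (L R) (A\<lparr>carrier := L S\<rparr>)"
    and L_empty: "L {} = {\<one>\<^bsub>A\<^esub>}"
    and L_generate: "L X = generate A (\<Union>{L S | S. S \<subseteq> X \<and> finite S})"
    and L_Int: "R \<subseteq> X \<Longrightarrow> S \<subseteq> X \<Longrightarrow> L R \<inter> L S = L (R \<inter> S)"

locale halo_product_data =
  H: group H + halo_of_groups "carrier H" A L
  for H :: "('h, 'm) monoid_scheme" and A :: "('a, 'n) monoid_scheme"
    and L :: "'h set \<Rightarrow> 'a set" +
  fixes \<alpha> :: "'h \<Rightarrow> 'a \<Rightarrow> 'a"
  assumes \<alpha>_hom: "\<alpha> \<in> hom H (AutoGroup A)"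
    and \<alpha>_L: "h \<in> carrier H \<Longrightarrow> S \<subseteq> carrier H \<Longrightarrow> \<alpha> h ` L S = L (h <#\<^bsub>H\<^esub> S)"

text \<open>Distance between subsets; it is \<open>\<infinity>\<close> if one of them is empty.\<close>
definition set_distance :: "('x \<Rightarrow> 'x \<Rightarrow> real) \<Rightarrow> 'x set \<Rightarrow> 'x set \<Rightarrow> ereal" where
  "set_distance d R S = (INF (r, s) \<in> R \<times> S. ereal (d r s))"

definition full_halo ::
  "'x set \<Rightarrow> ('x \<Rightarrow> 'x \<Rightarrow> real) \<Rightarrow> ('a, 'n) monoid_scheme \<Rightarrow> ('x set \<Rightarrow> 'a set) \<Rightarrow> bool" where
  "full_halo X d A L \<longleftrightarrow>
     (\<exists>K\<ge>0. \<forall>R S T U. R \<subseteq> X \<and> S \<subseteq> X \<and> T \<subseteq> X \<and> U \<subseteq> X \<and>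
        set_distance d R S \<ge> ereal K \<and> set_distance d R T \<ge> ereal K \<and>
        set_distance d R U \<ge> ereal K \<and> set_distance d S T \<ge> ereal K \<longrightarrow>
        (L (R \<union> S) <#>\<^bsub>A\<^esub> L U) \<inter> L (R \<union> T) \<subseteq> L R <#>\<^bsub>A\<^esub> L T)"


section \<open>Geodesic spaces and the thick bigon property\<close>

definition geodesic_space :: "'z::metric_space set \<Rightarrow> bool" where
  "geodesic_space Z \<longleftrightarrow>
     (\<forall>x\<in>Z. \<forall>y\<in>Z. \<exists>g :: real \<Rightarrow> 'z.
        g ` {0..dist x y} \<subseteq> Z \<and> g 0 = x \<and> g (dist x y) = y \<and>
        (\<forall>s\<in>{0..dist x y}. \<forall>t\<in>{0..dist x y}. dist (g s) (g t) = \<bar>s - t\<bar>))"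

definition path_between :: "'z::metric_space set \<Rightarrow> 'z \<Rightarrow> 'z \<Rightarrow> (real \<Rightarrow> 'z) \<Rightarrow> bool" where
  "path_between Z x y g \<longleftrightarrow>
     path g \<and> path_image g \<subseteq> Z \<and> pathstart g = x \<and> pathfinish g = y"

text \<open>\<open>g'\<close> is obtained from \<open>g\<close> by replacing the subpath of \<open>g\<close> on \<open>[s,t]\<close> by the subpath
  of \<open>g'\<close> on \<open>[s',t']\<close>; the remaining initial and final pieces of the two paths agree up to
  affine reparametrisation. Allowing \<open>(s,t) \<noteq> (s',t')\<close> permits, for instance, the
  replacement of a trivial subpath by a loop. That the two subpaths have the same
  endpoints is the case \<open>u = 1\<close> of the two equations.\<close>
definition subpath_replacement ::
  "real \<Rightarrow> (real \<Rightarrow> 'z::metric_space) \<Rightarrow> (real \<Rightarrow> 'z) \<Rightarrow> bool" where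
  "subpath_replacement C g g' \<longleftrightarrow>
     (\<exists>s t s' t'. 0 \<le> s \<and> s \<le> t \<and> t \<le> 1 \<and> 0 \<le> s' \<and> s' \<le> t' \<and> t' \<le> 1 \<and>
        (\<forall>u\<in>{0..1}. g' (s' * u) = g (s * u)) \<and>
        (\<forall>u\<in>{0..1}. g' (1 - (1 - t') * u) = g (1 - (1 - t) * u)) \<and>
        diameter (g ` {s..t} \<union> g' ` {s'..t'}) \<le> C)"

definition coarsely_homotopic ::
  "'z::metric_space set \<Rightarrow> real \<Rightarrow> (real \<Rightarrow> 'z) \<Rightarrow> (real \<Rightarrow> 'z) \<Rightarrow> bool" where
  "coarsely_homotopic Z C a b \<longleftrightarrow>
     (\<exists>(n::nat) \<gamma>. \<gamma> 0 = a \<and> \<gamma> n = b \<and>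
        (\<forall>i\<le>n. path_between Z (pathstart a) (pathfinish a) (\<gamma> i)) \<and>
        (\<forall>i<n. subpath_replacement C (\<gamma> i) (\<gamma> (Suc i))))"

definition thick_bigon_property :: "'z::metric_space set \<Rightarrow> bool" where
  "thick_bigon_property Z \<longleftrightarrow>
     (\<exists>C\<ge>0. \<forall>R\<ge>0. \<exists>M\<ge>0. \<forall>x\<in>Z. \<forall>y\<in>Z. \<exists>g1. path_between Z x y g1 \<and>
        (\<forall>p\<in>path_image g1. dist x p \<ge> M \<and> dist y p \<ge> M \<longrightarrow>
           (\<exists>g2. path_between Z x y g2 \<and> coarsely_homotopic Z C g1 g2 \<and>
                 path_image g2 \<inter> cball p R = {})))"


section \<open>Coarse embeddings\<close>

text \<open>The upper control function is required to be bounded on bounded intervals, which holds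
  for every nondecreasing function. This is implicit in the notion of a control function:
  without it \<open>\<lambda>x. \<lfloor>\<bar>f x\<bar>\<rfloor>\<close>, for a nonzero \<open>\<rat>\<close>-linear \<open>f : \<real> \<rightarrow> \<rat>\<close> vanishing at \<open>1\<close>, would be
  a coarse embedding of \<open>[0,1]\<close> into \<open>\<int>\<close> with unbounded image.\<close>
definition coarse_parameters :: "(real \<Rightarrow> real) \<Rightarrow> (real \<Rightarrow> real) \<Rightarrow> bool" where
  "coarse_parameters \<sigma>\<^sub>1 \<sigma>\<^sub>2 \<longleftrightarrow>
     (\<forall>t\<ge>0. 0 \<le> \<sigma>\<^sub>1 t) \<and> (\<forall>t\<ge>0. 0 \<le> \<sigma>\<^sub>2 t) \<and>
     filterlim \<sigma>\<^sub>1 at_top at_top \<and> filterlim \<sigma>\<^sub>2 at_top at_top \<and>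
     (\<forall>t\<ge>0. bdd_above (\<sigma>\<^sub>2 ` {0..t}))"

definition coarse_embedding ::
  "(real \<Rightarrow> real) \<Rightarrow> (real \<Rightarrow> real) \<Rightarrow> 'z::metric_space set \<Rightarrow> 'y set \<Rightarrow> ('y \<Rightarrow> 'y \<Rightarrow> real) \<Rightarrow>
     ('z \<Rightarrow> 'y) \<Rightarrow> bool" where
  "coarse_embedding \<sigma>\<^sub>1 \<sigma>\<^sub>2 Z Y d f \<longleftrightarrow>
     coarse_parameters \<sigma>\<^sub>1 \<sigma>\<^sub>2 \<and> f ` Z \<subseteq> Y \<and>
     (\<forall>x\<in>Z. \<forall>y\<in>Z. \<sigma>\<^sub>1 (dist x y) \<le> d (f x) (f y) \<and> d (f x) (f y) \<le> \<sigma>\<^sub>2 (dist x y))"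

definition neighbourhood :: "'y set \<Rightarrow> ('y \<Rightarrow> 'y \<Rightarrow> real) \<Rightarrow> 'y set \<Rightarrow> real \<Rightarrow> 'y set" where
  "neighbourhood Y d B D = {y \<in> Y. \<exists>b\<in>B. d y b \<le> D}"

end

theory Submission
  imports Defs
begin

text \<open>
  Write a point of the halo product as a colour \<open>a \<in> L(H)\<close> together with an arrow \<open>h \<in> H\<close>, and let
  \<open>\<rho>\<close> send \<open>z\<close> to \<open>(a z, h z)\<close>. A bounded move in the halo product moves the arrow by a bounded
  amount and changes the colour by an element of a finite group supported near the arrow
  (\<open>displacement\<close>, \<open>finite_moves\<close>, \<open>moves_support\<close>). Being close to the coset \<open>c H\<close> means that,
  after translating the arrow to the identity, \<open>(a z)\<inverse> c\<close> lies in a fixed finite set.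

  Fix \<open>q \<in> H\<close> and two points \<open>x, y\<close> of \<open>Z\<close> whose arrows are far from \<open>q\<close>. While the arrow of a path
  from \<open>x\<close> to \<open>y\<close> is near \<open>q\<close> the colour only changes near \<open>q\<close>; otherwise it only changes in the
  complement of \<open>q\<close>. Recording the colour modulo changes of the respective kind turns the path
  into a walk in a graph of cosets, in which coarsely homotopic paths give the same reduced walk,
  as the labels met by a subpath of small diameter are the ends of a single edge.
  The points with one and the same label near \<open>q\<close> form a bounded subset of \<open>Z\<close>, since \<open>\<rho>\<close> is a
  coarse embedding. A thick bigon avoids this set, so the label does not occur in the reduced
  walk; hence no label near \<open>q\<close> does, the walk is trivial, and \<open>(a x)\<inverse> a y\<close> is supported off \<open>q\<close>
  (\<open>avoidable_vertices_imp_same_class\<close>). Letting \<open>q\<close> vary, \<open>(a x)\<inverse> a y\<close> is supported in the union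
  of two balls around \<open>h x\<close> and \<open>h y\<close> (\<open>change_supported_near_ends\<close>).

  Fullness, applied to three points with arrows far apart, splits such an element into a part
  near \<open>h x\<close> and a part near \<open>h y\<close>. This yields one colour \<open>c\<close> from which every \<open>a z\<close> differs near
  \<open>h z\<close> only (\<open>common_coset\<close>). That only finitely many differences occur follows by moving from
  \<open>z\<close> to a point with disjoint support: the colour change along the way is one of finitely many
  elements, and it determines both differences (\<open>colour_in_rigid_colours\<close>).
\<close>

section \<open>Reduced walks\<close>

text \<open>A walk without backtracking is stored as the list of its vertices, the current one first.
  Moving to \<open>w\<close> lengthens the walk, unless \<open>w\<close> is the current vertex or the one before it.
  Walks without backtracking from a fixed vertex are the vertices of the universal cover of a
  graph, so this is the motion in that tree lifting a motion in the graph.\<close>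
definition tree_step :: "'v list \<Rightarrow> 'v \<Rightarrow> 'v list" where
  "tree_step \<sigma> w =
     (case \<sigma> of [] \<Rightarrow> [w]
      | x # \<tau> \<Rightarrow> if w = x then \<sigma> else if \<tau> \<noteq> [] \<and> w = hd \<tau> then \<tau> else w # \<sigma>)"

text \<open>Vertices carry a Boolean type, and edges join vertices of different types; the graph is thus
  bipartite, and a reduced walk visiting only one type is constant.\<close>
fun backtrack_free :: "(bool \<times> 'b) list \<Rightarrow> bool" where
  "backtrack_free (x # y # \<tau>) \<longleftrightarrow>
     fst x \<noteq> fst y \<and> (\<tau> \<noteq> [] \<longrightarrow> x \<noteq> hd \<tau>) \<and> backtrack_free (y # \<tau>)"
| "backtrack_free [x] \<longleftrightarrow> True"
| "backtrack_free [] \<longleftrightarrow> False"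

text \<open>Two vertices are compatible if they are equal or may be joined by an edge. Among three
  pairwise compatible vertices two have the same type, hence coincide: there are no triangles.\<close>
definition compatible :: "(bool \<times> 'b) \<Rightarrow> (bool \<times> 'b) \<Rightarrow> bool" where
  "compatible v w \<longleftrightarrow> (fst v = fst w \<longrightarrow> v = w)"

lemma backtrack_free_ne: "backtrack_free \<sigma> \<Longrightarrow> \<sigma> \<noteq> []"
  by auto

lemma tree_step_self: "\<sigma> \<noteq> [] \<Longrightarrow> tree_step \<sigma> (hd \<sigma>) = \<sigma>"
  by (cases \<sigma>) (auto simp: tree_step_def)

lemma hd_tree_step [simp]: "hd (tree_step \<sigma> w) = w"
  by (auto simp: tree_step_def split: list.splits)

lemma set_tree_step: "set (tree_step \<sigma> w) \<subseteq> insert w (set \<sigma>)"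
  by (auto simp: tree_step_def split: list.splits)

lemma last_tree_step: "\<sigma> \<noteq> [] \<Longrightarrow> last (tree_step \<sigma> w) = last \<sigma>"
  by (auto simp: tree_step_def split: list.splits)

lemma backtrack_free_Cons:
  "\<sigma> \<noteq> [] \<Longrightarrow> backtrack_free (w # \<sigma>) \<longleftrightarrow>
     fst w \<noteq> fst (hd \<sigma>) \<and> (tl \<sigma> \<noteq> [] \<longrightarrow> w \<noteq> hd (tl \<sigma>)) \<and> backtrack_free \<sigma>"
  by (cases \<sigma>) auto

lemma backtrack_free_tree_step:
  assumes "backtrack_free \<sigma>" "compatible (hd \<sigma>) w"
  shows "backtrack_free (tree_step \<sigma> w)"
proof -
  obtain x \<tau> where \<sigma>: "\<sigma> = x # \<tau>"
    using assms(1) by (cases \<sigma>) auto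
  consider "w = x" | "w \<noteq> x" "\<tau> \<noteq> []" "w = hd \<tau>" | "w \<noteq> x" "\<not> (\<tau> \<noteq> [] \<and> w = hd \<tau>)"
    by blast
  then show ?thesis
  proof cases
    case 1
    then show ?thesis using assms(1) \<sigma> by (simp add: tree_step_def)
  next
    case 2
    then show ?thesis using assms(1) \<sigma> by (simp add: tree_step_def backtrack_free_Cons)
  next
    case 3
    moreover have "fst w \<noteq> fst x" using 3 assms(2) \<sigma> by (auto simp: compatible_def)
    ultimately have "backtrack_free (w # \<sigma>)"
      using assms(1) \<sigma> backtrack_free_Cons[of \<sigma> w] by auto
    moreover have "tree_step \<sigma> w = w # \<sigma>" using 3 \<sigma> by (auto simp: tree_step_def)
    ultimately show ?thesis by simp
  qed
qed

text \<open>Since there are no triangles, a small detour through \<open>w\<close> is invisible: one of the two moves is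
  trivial, or the second undoes the first. In the last case the walk \<open>x, w, x\<close> cannot already be
  recorded, because \<open>\<sigma>\<close> has no backtracking. This is the whole local content of homotopy
  invariance.\<close>
lemma tree_step_tree_step:
  assumes "backtrack_free \<sigma>" "compatible (hd \<sigma>) w" "compatible w u" "compatible (hd \<sigma>) u"
  shows "tree_step (tree_step \<sigma> w) u = tree_step \<sigma> u"
proof -
  obtain x \<tau> where \<sigma>: "\<sigma> = x # \<tau>"
    using assms(1) by (cases \<sigma>) auto
  consider "w = x" | "u = w" | "u = x" "w \<noteq> x"
    using assms unfolding compatible_def \<sigma> by (metis (full_types) list.sel(1))
  then show ?thesis
  proof cases
    case 1
    then show ?thesis using tree_step_self[of \<sigma>] \<sigma> by simp
  next
    case 2
    then show ?thesis
      using tree_step_self[of "tree_step \<sigma> w"] backtrack_free_tree_step[OF assms(1,2)] 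
        backtrack_free_ne by fastforce
  next
    case 3
    show ?thesis
    proof (cases "\<tau> \<noteq> [] \<and> w = hd \<tau>")
      case True
      then have "tree_step \<sigma> w = \<tau>" using 3 \<sigma> by (simp add: tree_step_def)
      moreover have "tl \<tau> \<noteq> [] \<longrightarrow> x \<noteq> hd (tl \<tau>)" "x \<noteq> w"
        using assms(1) True 3 unfolding \<sigma> by (auto simp: backtrack_free_Cons)
      moreover obtain \<rho> where "\<tau> = w # \<rho>" using True by (cases \<tau>) auto
      ultimately show ?thesis using 3 \<sigma> by (auto simp: tree_step_def)
    next
      case False
      then show ?thesis using 3 \<sigma> by (auto simp: tree_step_def)
    qed
  qed
qed

section \<open>Lifting paths to the tree\<close>

text \<open>\<open>F\<close> follows the labels \<open>V (g t)\<close> in the tree. The second condition determines \<open>F\<close> from any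
  of its values, like a flat connection; it replaces continuity, since \<open>V\<close> is locally constant
  only up to moves between adjacent vertices.\<close>
definition is_lift :: "('z \<Rightarrow> bool \<times> 'b) \<Rightarrow> (real \<Rightarrow> 'z) \<Rightarrow> (real \<Rightarrow> (bool \<times> 'b) list) \<Rightarrow> bool" where
  "is_lift V g F \<longleftrightarrow>
     (\<forall>t\<in>{0..1}. backtrack_free (F t) \<and> hd (F t) = V (g t)) \<and>
     (\<exists>\<delta>>0. \<forall>t\<in>{0..1}. \<forall>t'\<in>{0..1}. \<bar>t - t'\<bar> < \<delta> \<longrightarrow> F t' = tree_step (F t) (V (g t')))"

lemma is_lift_unique:
  assumes "is_lift V g F" "is_lift V g' F'" "\<And>t. t \<in> {0..1} \<Longrightarrow> g t = g' t"
    and "F 0 = F' 0" "t \<in> {0..1}"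
  shows "F t = F' t"
proof -
  obtain \<delta> where \<delta>: "\<delta> > 0"
      "\<And>t t'. t \<in> {0..1} \<Longrightarrow> t' \<in> {0..1} \<Longrightarrow> \<bar>t - t'\<bar> < \<delta> \<Longrightarrow> F t' = tree_step (F t) (V (g t'))"
    using assms(1) unfolding is_lift_def by metis
  obtain \<delta>' where \<delta>': "\<delta>' > 0"
      "\<And>t t'. t \<in> {0..1} \<Longrightarrow> t' \<in> {0..1} \<Longrightarrow> \<bar>t - t'\<bar> < \<delta>' \<Longrightarrow> F' t' = tree_step (F' t) (V (g' t'))"
    using assms(2) unfolding is_lift_def by metis
  obtain n :: nat where n: "0 < n" "1 / real n < min \<delta> \<delta>'"
    using \<delta>(1) \<delta>'(1) nat_approx_posE[of "min \<delta> \<delta>'"]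
    by (metis min_less_iff_conj zero_less_Suc)
  \<comment> \<open>subdivide \<open>[0,t]\<close> so finely that the defining condition of both lifts applies to each step\<close>
  have "i \<le> n \<Longrightarrow> F (t * i / n) = F' (t * i / n)" for i :: nat
  proof (induction i)
    case 0
    then show ?case using assms(4) by simp
  next
    case (Suc i)
    let ?s = "t * i / n" and ?s' = "t * Suc i / n"
    have *: "t * k / n \<in> {0..1}" if "k \<le> n" for k :: nat
      using that n(1) assms(5) mult_mono[of t 1 "real k" "real n"] by auto
    have I: "?s \<in> {0..1}" "?s' \<in> {0..1}"
      using *[of i] *[of "Suc i"] Suc.prems by auto
    have "?s' - ?s = t / n" using n(1) by (simp add: field_simps)
    moreover have "t / n \<le> 1 / n" using assms(5) n(1) by (intro divide_right_mono) auto
    moreover have "0 \<le> t / n" using assms(5) by auto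
    ultimately have "\<bar>?s - ?s'\<bar> < \<delta>" "\<bar>?s - ?s'\<bar> < \<delta>'" using n(2) by auto
    then show ?case
      using \<delta>(2)[OF I] \<delta>'(2)[OF I] Suc assms(3)[OF I(2)] by simp
  qed
  from this[of n] show ?thesis using n(1) by simp
qed

lemma is_lift_affine:
  assumes "is_lift V g F" "a \<in> {0..1}" "b \<in> {0..1}"
  shows "is_lift V (\<lambda>u. g (a + (b - a) * u)) (\<lambda>u. F (a + (b - a) * u))"
proof -
  have I: "a + (b - a) * u \<in> {0..1}" if "u \<in> {0..1}" for u
  proof -
    have "a + (b - a) * u = (1 - u) * a + u * b" by (simp add: algebra_simps)
    moreover have "(1 - u) * a + u * b \<in> {0..1}"
      using that assms(2,3) convex_bound_le[of a 1 b "1-u" u] by auto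
    ultimately show ?thesis by simp
  qed
  obtain \<delta> where \<delta>: "\<delta> > 0"
      "\<And>t t'. t \<in> {0..1} \<Longrightarrow> t' \<in> {0..1} \<Longrightarrow> \<bar>t - t'\<bar> < \<delta> \<Longrightarrow> F t' = tree_step (F t) (V (g t'))"
    using assms(1) unfolding is_lift_def by metis
  have "F (a + (b - a) * t') = tree_step (F (a + (b - a) * t)) (V (g (a + (b - a) * t')))"
    if t: "t \<in> {0..1}" "t' \<in> {0..1}" "\<bar>t - t'\<bar> < \<delta>" for t t'
  proof (rule \<delta>(2)[OF I[OF t(1)] I[OF t(2)]])
    have "\<bar>(a + (b - a) * t) - (a + (b - a) * t')\<bar> = \<bar>b - a\<bar> * \<bar>t - t'\<bar>"
      by (simp add: abs_mult[symmetric] algebra_simps)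
    also have "\<dots> \<le> 1 * \<bar>t - t'\<bar>" using assms(2,3) by (intro mult_right_mono) auto
    finally show "\<bar>(a + (b - a) * t) - (a + (b - a) * t')\<bar> < \<delta>" using t(3) by simp
  qed
  then show ?thesis using assms(1) I \<delta>(1) unfolding is_lift_def by blast
qed

text \<open>Along a path all of whose labels are pairwise compatible the labels run between two adjacent
  vertices, so the lift only depends on its starting point and the present label.\<close>
lemma is_lift_small:
  assumes "backtrack_free \<sigma>" "hd \<sigma> = V (g 0)"
    and "\<And>t t'. t \<in> {0..1} \<Longrightarrow> t' \<in> {0..1} \<Longrightarrow> compatible (V (g t)) (V (g t'))"
  shows "is_lift V g (\<lambda>t. tree_step \<sigma> (V (g t)))"
proof -
  have 1: "backtrack_free (tree_step \<sigma> (V (g t)))" if "t \<in> {0..1}" for t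
    using assms that by (intro backtrack_free_tree_step) auto
  have 2: "tree_step \<sigma> (V (g t')) = tree_step (tree_step \<sigma> (V (g t))) (V (g t'))"
    if "t \<in> {0..1}" "t' \<in> {0..1}" for t t'
    using assms that by (intro tree_step_tree_step[symmetric]) auto
  have 3: "(0::real) < 1" by simp
  show ?thesis
    unfolding is_lift_def
    by (intro conjI ballI exI[of _ "1::real"] impI 1 2 3 hd_tree_step)
qed

definition locally_compatible :: "'z::metric_space set \<Rightarrow> real \<Rightarrow> ('z \<Rightarrow> bool \<times> 'b) \<Rightarrow> bool" where
  "locally_compatible Z C V \<longleftrightarrow> (\<forall>z\<in>Z. \<forall>z'\<in>Z. dist z z' \<le> C \<longrightarrow> compatible (V z) (V z'))"

lemma path_fine:
  fixes g :: "real \<Rightarrow> 'z::metric_space"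
  assumes "path g" "0 < e"
  obtains n :: nat where "0 < n"
    "\<And>t t'. t \<in> {0..1} \<Longrightarrow> t' \<in> {0..1} \<Longrightarrow> \<bar>t - t'\<bar> \<le> 2 / n \<Longrightarrow> dist (g t) (g t') \<le> e"
proof -
  have "uniformly_continuous_on {0..1} g"
    using assms(1) compact_uniformly_continuous[of "{0..1}" g] by (simp add: path_def)
  then obtain d where d: "d > 0"
      "\<And>t t'. t \<in> {0..1} \<Longrightarrow> t' \<in> {0..1} \<Longrightarrow> dist t' t < d \<Longrightarrow> dist (g t') (g t) < e"
    using assms(2) unfolding uniformly_continuous_on_def by metis
  obtain n :: nat where n: "0 < n" "1 / real n < d / 2"
    using d(1) nat_approx_posE[of "d/2"] by (metis half_gt_zero zero_less_Suc)
  show thesis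
  proof (rule that[OF n(1)])
    fix t t' :: real assume t: "t \<in> {0..1}" "t' \<in> {0..1}" "\<bar>t - t'\<bar> \<le> 2 / n"
    have "2 / n < d" using n(2) by simp
    then have "dist t t' < d" using t(3) by (simp add: dist_real_def)
    then show "dist (g t) (g t') \<le> e" using d(2)[OF t(2,1)] by simp
  qed
qed

text \<open>The lift is built along a uniform subdivision with \<open>n\<close> pieces that are so short that labels at
  times differing by at most \<open>2 / n\<close> are compatible. It starts with the one-vertex walk; walks
  only record labels that were met on the way and never forget their origin.\<close>
lemma is_lift_exists:
  assumes V: "locally_compatible Z C V" and C: "0 < C"
    and g: "path g" "path_image g \<subseteq> Z"
  obtains F where "is_lift V g F" "F 0 = [V (g 0)]"
    "\<And>t. t \<in> {0..1} \<Longrightarrow> last (F t) = V (g 0)"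
    "\<And>t. t \<in> {0..1} \<Longrightarrow> set (F t) \<subseteq> V ` path_image g"
proof -
  obtain n :: nat where n: "0 < n"
    and fine: "\<And>t t'. t \<in> {0..1} \<Longrightarrow> t' \<in> {0..1} \<Longrightarrow> \<bar>t - t'\<bar> \<le> 2 / n \<Longrightarrow> dist (g t) (g t') \<le> C"
    using path_fine[OF g(1) C] by metis
  have gI: "g t \<in> path_image g" if "t \<in> {0..1}" for t
    using that by (auto simp: path_image_def)
  have cpt: "compatible (V (g t)) (V (g t'))"
    if "t \<in> {0..1}" "t' \<in> {0..1}" "\<bar>t - t'\<bar> \<le> 2 / n" for t t'
    using V fine[OF that] g(2) gI that unfolding locally_compatible_def by blast
  \<comment> \<open>\<open>s i\<close> is the walk reached at time \<open>i / n\<close>, and \<open>k t\<close> the number of the piece containing \<open>t\<close>\<close>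
  define s where "s = rec_nat [V (g 0)] (\<lambda>i \<sigma>. tree_step \<sigma> (V (g (Suc i / n))))"
  have s0: "s 0 = [V (g 0)]" and sS: "\<And>i. s (Suc i) = tree_step (s i) (V (g (Suc i / n)))"
    by (auto simp: s_def)
  have U: "real i / n \<in> {0..1}" if "i \<le> n" for i using that n by auto
  have s: "backtrack_free (s i) \<and> last (s i) = V (g 0) \<and> hd (s i) = V (g (i / n)) \<and> set (s i) \<subseteq> V ` path_image g"
    if "i \<le> n" for i
    using that
  proof (induction i)
    case 0
    then show ?case using gI[of 0] by (auto simp: s0)
  next
    case (Suc i)
    then have IH: "backtrack_free (s i)" "last (s i) = V (g 0)" "hd (s i) = V (g (i / n))" "set (s i) \<subseteq> V ` path_image g"
      by auto
    have "real i / n \<in> {0..1}" "real (Suc i) / n \<in> {0..1}" using U Suc.prems by auto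
    moreover have "\<bar>real i / n - real (Suc i) / n\<bar> \<le> 2 / n"
      using n by (simp add: field_simps)
    ultimately have "compatible (V (g (i / n))) (V (g (Suc i / n)))" by (rule cpt)
    then show ?case
      using IH backtrack_free_tree_step[OF IH(1)] set_tree_step[of "s i" "V (g (Suc i / n))"]
        gI[OF \<open>real (Suc i) / n \<in> {0..1}\<close>] last_tree_step[OF backtrack_free_ne[OF IH(1)]]
      unfolding sS by auto
  qed
  define k where "k t = nat \<lfloor>n * t\<rfloor>" for t :: real
  have k: "k t \<le> n" "k t / n \<le> t" "t < k t / n + 1 / n" if "t \<in> {0..1}" for t
  proof -
    have *: "real (k t) \<le> n * t" "n * t < k t + 1"
      using that real_of_int_floor_add_one_gt[of "n * t"] unfolding k_def
      by (auto simp: add.commute)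
    have "n * t \<le> n" using that n by (simp add: mult_left_le)
    then show "k t \<le> n" using * by linarith
    show "k t / n \<le> t" "t < k t / n + 1 / n" using * n by (simp_all add: field_simps)
  qed
  define F where "F t = tree_step (s (k t)) (V (g t))" for t
  have comb: "tree_step (tree_step (s i) (V (g t))) (V (g t')) = tree_step (s i) (V (g t'))"
    if "i \<le> n" "t \<in> {0..1}" "t' \<in> {0..1}"
      "\<bar>i / n - t\<bar> \<le> 2 / n" "\<bar>i / n - t'\<bar> \<le> 2 / n" "\<bar>t - t'\<bar> \<le> 2 / n" for i t t'
    using s[OF that(1)] cpt[OF U[OF that(1)]] cpt that
    by (intro tree_step_tree_step) auto
  have F: "F t' = tree_step (F t) (V (g t'))"
    if t: "t \<in> {0..1}" "t' \<in> {0..1}" and d: "\<bar>t - t'\<bar> < 1 / n" for t t'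
  proof -
    note kt = k[OF t(1)] and kt' = k[OF t(2)]
    have two: "2 / real n = 1 / n + 1 / n" by simp
    have "real (k t) / n < (real (k t') + 2) / n" "real (k t') / n < (real (k t) + 2) / n"
      using kt kt' d by (auto simp: add_divide_distrib)
    then have "k t < k t' + 2" "k t' < k t + 2"
      using n by (simp_all add: divide_less_cancel)
    \<comment> \<open>times less than \<open>1 / n\<close> apart lie in the same or in adjacent pieces\<close>
    then consider "k t' = k t" | "k t' = Suc (k t)" | "k t = Suc (k t')"
      by linarith
    then show ?thesis
    proof cases
      case 1
      have "tree_step (F t) (V (g t')) = tree_step (s (k t)) (V (g t'))"
        unfolding F_def using kt kt' d 1 two by (intro comb t) (auto simp: abs_if)
      then show ?thesis unfolding F_def 1 by simp
    next
      case 2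
      have e: "real (Suc (k t)) / n = k t / n + 1 / n" by (simp add: add_divide_distrib)
      have "tree_step (F t) (V (g t')) = tree_step (s (k t)) (V (g t'))"
        unfolding F_def using kt kt' d two e unfolding 2
        by (intro comb t) (auto simp: abs_if)
      moreover have "F t' = tree_step (s (k t)) (V (g t'))"
        unfolding F_def 2 sS using kt kt' d two e U[of "Suc (k t)"] unfolding 2
        by (intro comb t) (auto simp: abs_if)
      ultimately show ?thesis by simp
    next
      case 3
      have e: "real (Suc (k t')) / n = k t' / n + 1 / n" by (simp add: add_divide_distrib)
      have "F t = tree_step (s (k t')) (V (g t))"
        unfolding F_def 3 sS using kt kt' d two e U[of "Suc (k t')"] unfolding 3
        by (intro comb t) (auto simp: abs_if)
      moreover have "tree_step (tree_step (s (k t')) (V (g t))) (V (g t')) = tree_step (s (k t')) (V (g t'))"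
        using kt kt' d two e unfolding 3
        by (intro comb t) (auto simp: abs_if)
      ultimately show ?thesis unfolding F_def by simp
    qed
  qed
  have good: "backtrack_free (F t) \<and> last (F t) = V (g 0) \<and> hd (F t) = V (g t) \<and> set (F t) \<subseteq> V ` path_image g"
    if t: "t \<in> {0..1}" for t
  proof -
    have "compatible (V (g (k t / n))) (V (g t))"
      using k[OF t] U t by (intro cpt) (auto simp: abs_if)
    then show ?thesis
      using s[OF k(1)[OF t]] backtrack_free_tree_step[of "s (k t)" "V (g t)"] gI[OF t]
        set_tree_step[of "s (k t)" "V (g t)"] backtrack_free_ne[of "s (k t)"]
        last_tree_step[of "s (k t)" "V (g t)"]
      unfolding F_def by auto
  qed
  show thesis
  proof (rule that[of F])
    show "is_lift V g F"
      unfolding is_lift_def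
    proof (intro conjI ballI exI[of _ "1 / real n"] impI)
      show "0 < 1 / real n" using n by simp
    qed (use good F in blast)+
    have "k 0 = 0" by (simp add: k_def)
    then show "F 0 = [V (g 0)]" by (simp add: F_def s0 tree_step_def)
  qed (use good in blast)+
qed

section \<open>Homotopy invariance of the lift\<close>

text \<open>The two lifts agree up to the replaced subpath by uniqueness, at its end because both subpaths
  stay among pairwise compatible labels, and from there on by uniqueness again.\<close>
lemma is_lift_subpath_replacement:
  fixes g g' :: "real \<Rightarrow> 'z::metric_space"
  assumes V: "locally_compatible Z C V"
    and g: "path g" "path_image g \<subseteq> Z" "path g'" "path_image g' \<subseteq> Z"
    and rep: "subpath_replacement C g g'"
    and F: "is_lift V g F" "is_lift V g' F'" "F 0 = F' 0"
  shows "F 1 = F' 1"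
proof -
  obtain s t s' t' where
    st: "0 \<le> s" "s \<le> t" "t \<le> 1" "0 \<le> s'" "s' \<le> t'" "t' \<le> 1"
    and ini: "\<And>u. u \<in> {0..1} \<Longrightarrow> g' (s' * u) = g (s * u)"
    and fin: "\<And>u. u \<in> {0..1} \<Longrightarrow> g' (1 - (1 - t') * u) = g (1 - (1 - t) * u)"
    and diam: "diameter (g ` {s..t} \<union> g' ` {s'..t'}) \<le> C"
    using rep unfolding subpath_replacement_def by blast
  define W where "W = g ` {s..t} \<union> g' ` {s'..t'}"
  have "compact (g ` {s..t})" "compact (g' ` {s'..t'})"
    using g(1,3) st unfolding path_def
    by (auto intro!: compact_continuous_image intro: continuous_on_subset)
  then have bW: "bounded W" unfolding W_def by (simp add: compact_imp_bounded)
  have WZ: "W \<subseteq> Z" using g(2,4) st unfolding W_def path_image_def by fastforce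
  have cW: "compatible (V z) (V z')" if "z \<in> W" "z' \<in> W" for z z'
  proof -
    have "dist z z' \<le> C"
      using diameter_bounded_bound[OF bW that] diam unfolding W_def by linarith
    then show ?thesis using V WZ that unfolding locally_compatible_def by blast
  qed
  have A: "F s = F' s'"
    using is_lift_unique[OF is_lift_affine[OF F(1), of 0 s] is_lift_affine[OF F(2), of 0 s'], of 1]
      st ini F(3) by auto
  have mid: "a + (b - a) * u \<in> {a..b}" if "u \<in> {0..1}" "a \<le> b" for a b u :: real
    using that mult_left_le[of u "b - a"] by auto
  have B: "G b = tree_step (G a) (V (k b))"
    if "is_lift V k G" "0 \<le> a" "a \<le> b" "b \<le> 1" "k ` {a..b} \<subseteq> W" for G k and a b :: real
  proof -
    let ?k = "\<lambda>u. k (a + (b - a) * u)"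
    have kW: "?k u \<in> W" if "u \<in> {0..1}" for u
      using mid[OF that \<open>a \<le> b\<close>] \<open>k ` {a..b} \<subseteq> W\<close> by blast
    have G: "backtrack_free (G a)" "hd (G a) = V (k a)"
      using that unfolding is_lift_def by auto
    have "is_lift V ?k (\<lambda>u. tree_step (G a) (V (?k u)))"
      using G cW kW by (intro is_lift_small) auto
    from is_lift_unique[OF is_lift_affine[OF that(1), of a b] this _ _ , of 1] that G
    show ?thesis using tree_step_self[OF backtrack_free_ne[OF G(1)]] by auto
  qed
  have "g' s' = g s" "g' t' = g t" using ini[of 1] fin[of 1] by auto
  then have "F t = F' t'"
    using B[OF F(1), of s t] B[OF F(2), of s' t'] st A unfolding W_def by simp
  then show ?thesis
    using is_lift_unique[OF is_lift_affine[OF F(1), of t 1] is_lift_affine[OF F(2), of t' 1], of 1]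
      st fin[of "1 - u" for u] by (auto simp: algebra_simps)
qed

lemma is_lift_coarsely_homotopic:
  fixes a b :: "real \<Rightarrow> 'z::metric_space"
  assumes V: "locally_compatible Z C V" and C: "0 < C" "C' \<le> C"
    and hom: "coarsely_homotopic Z C' a b"
    and F: "is_lift V a F" "is_lift V b F'" "F 0 = [V (a 0)]" "F' 0 = [V (a 0)]"
  shows "F 1 = F' 1"
proof -
  obtain n :: nat and \<gamma> where \<gamma>: "\<gamma> 0 = a" "\<gamma> n = b"
    and pb: "\<And>i. i \<le> n \<Longrightarrow> path_between Z (pathstart a) (pathfinish a) (\<gamma> i)"
    and rep: "\<And>i. i < n \<Longrightarrow> subpath_replacement C' (\<gamma> i) (\<gamma> (Suc i))"
    using hom unfolding coarsely_homotopic_def by blast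
  have rep': "subpath_replacement C (\<gamma> i) (\<gamma> (Suc i))" if "i < n" for i
    using rep[OF that] C(2) unfolding subpath_replacement_def by (meson order_trans)
  have "\<forall>G. is_lift V (\<gamma> i) G \<and> G 0 = [V (a 0)] \<longrightarrow> F 1 = G 1" if "i \<le> n" for i
    using that
  proof (induction i)
    case 0
    then show ?case
      using is_lift_unique[OF F(1), of a _ 1] F(3) \<gamma>(1) by auto
  next
    case (Suc i)
    have pi: "path (\<gamma> i)" "path_image (\<gamma> i) \<subseteq> Z" "\<gamma> i 0 = a 0"
      and pS: "path (\<gamma> (Suc i))" "path_image (\<gamma> (Suc i)) \<subseteq> Z"
      using pb[of i] pb[of "Suc i"] Suc.prems unfolding path_between_def pathstart_def by auto
    obtain G where G: "is_lift V (\<gamma> i) G" "G 0 = [V (\<gamma> i 0)]"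
      using is_lift_exists[OF V C(1) pi(1,2)] by metis
    then have "F 1 = G 1" using Suc pi(3) by simp
    moreover have "G 1 = G' 1" if "is_lift V (\<gamma> (Suc i)) G'" "G' 0 = [V (a 0)]" for G'
      using is_lift_subpath_replacement[OF V pi(1,2) pS rep' G(1) that(1)] Suc.prems G(2) pi(3) that(2)
      by auto
    ultimately show ?case by simp
  qed
  from this[of n] show ?thesis using F \<gamma>(2) by blast
qed

text \<open>The lift of \<open>g\<close> ends at the reduced walk from \<open>V x\<close> to \<open>V y\<close>. By homotopy invariance the
  lift of \<open>g'\<close> ends at the same walk, which therefore only visits labels met by \<open>g'\<close>. If every
  vertex of type \<open>True\<close> on \<open>g\<close> can be avoided in this way, then the walk has none; as types
  alternate along it, it is constant.\<close>
lemma avoidable_vertices_imp_same_class: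
  fixes x y :: "'z::metric_space"
  assumes V: "locally_compatible Z C V" and C: "0 < C" "C' \<le> C"
    and g: "path_between Z x y g"
    and avoid: "\<And>p. p \<in> path_image g \<Longrightarrow> fst (V p) \<Longrightarrow>
      \<exists>g'. path_between Z x y g' \<and> coarsely_homotopic Z C' g g' \<and> V p \<notin> V ` path_image g'"
  shows "V x = V y"
proof -
  have g': "path g" "path_image g \<subseteq> Z" "g 0 = x" "g 1 = y"
    using g unfolding path_between_def pathstart_def pathfinish_def by auto
  obtain F where F: "is_lift V g F" "F 0 = [V (g 0)]"
    "\<And>t. t \<in> {0..1} \<Longrightarrow> last (F t) = V (g 0)"
    "\<And>t. t \<in> {0..1} \<Longrightarrow> set (F t) \<subseteq> V ` path_image g"
    using is_lift_exists[OF V C(1) g'(1,2)] by metis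
  have notB: "\<not> fst v" if v: "v \<in> set (F 1)" for v
  proof
    assume "fst v"
    obtain p where p: "p \<in> path_image g" "v = V p" using F(4)[of 1] v by auto
    obtain g2 where g2: "path_between Z x y g2" "coarsely_homotopic Z C' g g2" "V p \<notin> V ` path_image g2"
      using avoid p \<open>fst v\<close> by metis
    have g2': "path g2" "path_image g2 \<subseteq> Z" "g2 0 = x"
      using g2 unfolding path_between_def pathstart_def by auto
    obtain G where G: "is_lift V g2 G" "G 0 = [V (g2 0)]"
      "\<And>t. t \<in> {0..1} \<Longrightarrow> set (G t) \<subseteq> V ` path_image g2"
      using is_lift_exists[OF V C(1) g2'(1,2)] by metis
    have "F 1 = G 1"
      using is_lift_coarsely_homotopic[OF V C g2(2) F(1) G(1)] F(2) G(2) g2'(3) g'(3) by simp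
    then show False using G(3)[of 1] v p(2) g2(3) by auto
  qed
  have bf: "backtrack_free (F 1)" "hd (F 1) = V y" "last (F 1) = V x"
    using F(1) F(3)[of 1] g'(3) g'(4) unfolding is_lift_def by auto
  have "length (F 1) = 1"
    using bf(1) notB by (cases "F 1" rule: backtrack_free.cases) auto
  then show ?thesis using bf(2,3) by (cases "F 1") auto
qed

section \<open>Word metrics\<close>

context group begin

lemma foldr_mult_closed:
  "set ws \<subseteq> carrier G \<Longrightarrow> foldr (\<otimes>) ws \<one> \<in> carrier G"
  by (induction ws) auto

lemma foldr_mult_append:
  "set xs \<subseteq> carrier G \<Longrightarrow> set ys \<subseteq> carrier G \<Longrightarrow>
     foldr (\<otimes>) (xs @ ys) \<one> = foldr (\<otimes>) xs \<one> \<otimes> foldr (\<otimes>) ys \<one>"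
  by (induction xs) (auto simp: foldr_mult_closed m_assoc simp del: foldr_append)

lemma inv_foldr_mult:
  "set ws \<subseteq> carrier G \<Longrightarrow> inv (foldr (\<otimes>) ws \<one>) = foldr (\<otimes>) (rev (map (m_inv G) ws)) \<one>"
proof (induction ws)
  case (Cons w ws)
  then have "inv (foldr (\<otimes>) (w # ws) \<one>) = inv (foldr (\<otimes>) ws \<one>) \<otimes> inv w"
    using Cons.prems foldr_mult_closed[of ws] inv_mult_group[of w "foldr (\<otimes>) ws \<one>"] by simp
  also have "\<dots> = foldr (\<otimes>) (rev (map (m_inv G) ws) @ [inv w]) \<one>"
    using Cons by (subst foldr_mult_append) auto
  finally show ?case by simp
qed simp

end

lemma (in group) lcos_eq_iff:
  assumes "subgroup U G" "a \<in> carrier G" "b \<in> carrier G"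
  shows "a <# U = b <# U \<longleftrightarrow> inv a \<otimes> b \<in> U"
proof
  assume "a <# U = b <# U"
  moreover have "b \<in> b <# U"
    using assms subgroup.one_closed[OF assms(1)] unfolding l_coset_def by force
  ultimately obtain u where u: "u \<in> U" "b = a \<otimes> u" by (auto simp: l_coset_def)
  then have "inv a \<otimes> b = u"
    using assms subgroup.mem_carrier[OF assms(1)] by (simp add: m_assoc[symmetric])
  then show "inv a \<otimes> b \<in> U" using u by simp
next
  assume *: "inv a \<otimes> b \<in> U"
  have "b = a \<otimes> (inv a \<otimes> b)" using assms by (simp add: m_assoc[symmetric])
  then have "b \<in> a <# U" using * unfolding l_coset_def by blast
  then show "a <# U = b <# U" using assms by (intro l_repr_independence) auto
qed

locale fg_group = group +
  fixes S
  assumes fg: "finite_generating_set G S"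
begin

abbreviation letters where "letters \<equiv> S \<union> m_inv G ` S"

abbreviation len where "len \<equiv> word_length G S"

abbreviation wd where "wd \<equiv> word_metric G S"

lemma letters: "finite letters" "letters \<subseteq> carrier G"
  using fg by (auto simp: finite_generating_set_def)

lemma word_exists:
  assumes "g \<in> carrier G"
  shows "\<exists>ws. set ws \<subseteq> letters \<and> foldr (\<otimes>) ws \<one> = g"
proof -
  have "g \<in> generate G S" using assms fg by (simp add: finite_generating_set_def)
  then show ?thesis
  proof induction
    case one
    show ?case by (rule exI[of _ "[]"]) auto
  next
    case (incl h)
    then show ?case using letters by (intro exI[of _ "[h]"]) auto
  next
    case (inv h)
    then show ?case using letters by (intro exI[of _ "[inv h]"]) auto
  next
    case (eng h1 h2)
    then obtain xs ys where "set xs \<subseteq> letters" "foldr (\<otimes>) xs \<one> = h1"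
      "set ys \<subseteq> letters" "foldr (\<otimes>) ys \<one> = h2" by blast
    then show ?case
      using letters foldr_mult_append[of xs ys] by (intro exI[of _ "xs @ ys"]) auto
  qed
qed

lemma shortest_word:
  assumes "g \<in> carrier G"
  obtains ws where "length ws = len g" "set ws \<subseteq> letters" "foldr (\<otimes>) ws \<one> = g"
proof -
  let ?P = "\<lambda>n. \<exists>ws. length ws = n \<and> set ws \<subseteq> letters \<and> foldr (\<otimes>) ws \<one> = g"
  have "\<exists>n. ?P n" using word_exists[OF assms] by blast
  then have "?P (LEAST n. ?P n)" by (rule LeastI_ex)
  then show thesis using that unfolding word_length_def by blast
qed

lemma len_le: "set ws \<subseteq> letters \<Longrightarrow> foldr (\<otimes>) ws \<one> = g \<Longrightarrow> len g \<le> length ws"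
  unfolding word_length_def by (rule Least_le) blast

lemma len_one: "len \<one> = 0"
  using len_le[of "[]" \<one>] by simp

lemma len_mult:
  assumes "g \<in> carrier G" "h \<in> carrier G"
  shows "len (g \<otimes> h) \<le> len g + len h"
proof -
  obtain xs where xs: "length xs = len g" "set xs \<subseteq> letters" "foldr (\<otimes>) xs \<one> = g"
    using shortest_word[OF assms(1)] .
  obtain ys where ys: "length ys = len h" "set ys \<subseteq> letters" "foldr (\<otimes>) ys \<one> = h"
    using shortest_word[OF assms(2)] .
  have "foldr (\<otimes>) (xs @ ys) \<one> = g \<otimes> h"
    using xs ys letters foldr_mult_append[of xs ys] by (simp add: subset_trans)
  then show ?thesis using len_le[of "xs @ ys"] xs ys by simp
qed

lemma len_inv_le:
  assumes "g \<in> carrier G"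
  shows "len (inv g) \<le> len g"
proof -
  obtain xs where xs: "length xs = len g" "set xs \<subseteq> letters" "foldr (\<otimes>) xs \<one> = g"
    using shortest_word[OF assms] .
  have "set (rev (map (m_inv G) xs)) \<subseteq> letters"
  proof
    fix y assume "y \<in> set (rev (map (m_inv G) xs))"
    then obtain x where "x \<in> letters" "y = inv x" using xs(2) unfolding set_rev set_map by blast
    then show "y \<in> letters" using letters(2) by auto
  qed
  moreover have "foldr (\<otimes>) (rev (map (m_inv G) xs)) \<one> = inv g"
    using inv_foldr_mult[OF subset_trans[OF xs(2) letters(2)]] xs(3) by simp
  ultimately show ?thesis using len_le xs(1) by fastforce
qed

lemma len_inv: "g \<in> carrier G \<Longrightarrow> len (inv g) = len g"
  using len_inv_le[of g] len_inv_le[of "inv g"] by simp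

lemma finite_len_le: "finite {g \<in> carrier G. len g \<le> n}"
proof (rule finite_subset)
  show "{g \<in> carrier G. len g \<le> n} \<subseteq>
      (\<lambda>ws. foldr (\<otimes>) ws \<one>) ` {ws. set ws \<subseteq> letters \<and> length ws \<le> n}"
  proof
    fix g assume g: "g \<in> {g \<in> carrier G. len g \<le> n}"
    then obtain ws where "length ws = len g" "set ws \<subseteq> letters" "foldr (\<otimes>) ws \<one> = g"
      using shortest_word by blast
    then show "g \<in> (\<lambda>ws. foldr (\<otimes>) ws \<one>) ` {ws. set ws \<subseteq> letters \<and> length ws \<le> n}"
      using g by (intro image_eqI[of _ _ ws]) auto
  qed
  show "finite ((\<lambda>ws. foldr (\<otimes>) ws \<one>) ` {ws. set ws \<subseteq> letters \<and> length ws \<le> n})"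
    using letters(1) by (intro finite_imageI finite_lists_length_le)
qed

lemma wd_self: "g \<in> carrier G \<Longrightarrow> wd g g = 0"
  by (simp add: word_metric_def len_one)

lemma wd_sym:
  assumes "g \<in> carrier G" "h \<in> carrier G"
  shows "wd g h = wd h g"
proof -
  have "inv (inv g \<otimes> h) = inv h \<otimes> g" using assms by (simp add: inv_mult_group)
  then show ?thesis using assms len_inv[of "inv g \<otimes> h"] by (simp add: word_metric_def)
qed

lemma wd_triangle:
  assumes "g \<in> carrier G" "h \<in> carrier G" "k \<in> carrier G"
  shows "wd g k \<le> wd g h + wd h k"
proof -
  have "inv g \<otimes> k = (inv g \<otimes> h) \<otimes> (inv h \<otimes> k)"
    using assms by (metis inv_closed inv_solve_left m_assoc m_closed)
  then show ?thesis
    using assms len_mult[of "inv g \<otimes> h" "inv h \<otimes> k"] by (simp add: word_metric_def)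
qed

lemma wd_left_mult:
  assumes "g \<in> carrier G" "h \<in> carrier G" "k \<in> carrier G"
  shows "wd (k \<otimes> g) (k \<otimes> h) = wd g h"
proof -
  have "inv (k \<otimes> g) \<otimes> (k \<otimes> h) = inv g \<otimes> h"
    using assms by (simp add: inv_mult_group m_assoc) (simp add: m_assoc[symmetric])
  then show ?thesis by (simp add: word_metric_def)
qed

lemma wd_mult_right:
  "g \<in> carrier G \<Longrightarrow> t \<in> carrier G \<Longrightarrow> wd g (g \<otimes> t) = len t"
  by (simp add: word_metric_def m_assoc[symmetric])

definition wball where "wball g r = {h \<in> carrier G. wd g h \<le> r}"

lemma wball_subset: "wball g r \<subseteq> carrier G"
  by (auto simp: wball_def)

lemma wball_mono:
  assumes "g \<in> carrier G" "h \<in> carrier G" "wd h g + r \<le> s"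
  shows "wball g r \<subseteq> wball h s"
  using assms wd_triangle[of h g] unfolding wball_def by force

lemma finite_wball:
  assumes "g \<in> carrier G"
  shows "finite (wball g r)"
proof (rule finite_subset)
  show "wball g r \<subseteq> (\<lambda>t. g \<otimes> t) ` {t \<in> carrier G. len t \<le> nat \<lceil>r\<rceil>}"
  proof
    fix h assume h: "h \<in> wball g r"
    then have "h \<in> carrier G" "len (inv g \<otimes> h) \<le> nat \<lceil>r\<rceil>"
      unfolding wball_def word_metric_def by (auto, linarith)
    then show "h \<in> (\<lambda>t. g \<otimes> t) ` {t \<in> carrier G. len t \<le> nat \<lceil>r\<rceil>}"
      using assms by (intro image_eqI[of _ _ "inv g \<otimes> h"]) (auto simp: m_assoc[symmetric])
  qed
qed (use finite_len_le in blast)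

lemma left_mult_wball:
  assumes "g \<in> carrier G" "k \<in> carrier G"
  shows "k <# wball g r \<subseteq> wball (k \<otimes> g) r"
  using assms wd_left_mult unfolding l_coset_def wball_def by auto

end

section \<open>Supports in a halo\<close>

context halo_of_groups begin

lemma subgroup_L: "U \<subseteq> X \<Longrightarrow> subgroup (L U) A"
  using L_subgroup[of U X] by (simp add: L_top)

lemma L_mono: "R \<subseteq> U \<Longrightarrow> U \<subseteq> X \<Longrightarrow> L R \<subseteq> L U"
  using L_Int[of R U] by (auto simp: Int_absorb2)

lemma L_closed: "U \<subseteq> X \<Longrightarrow> a \<in> L U \<Longrightarrow> a \<in> carrier A"
  using L_mono[of U X] L_top by blast

lemma finite_support:
  assumes "a \<in> carrier A"
  obtains P where "finite P" "P \<subseteq> X" "a \<in> L P"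
proof -
  have "a \<in> generate A (\<Union>{L S | S. S \<subseteq> X \<and> finite S})"
    using assms L_top L_generate by simp
  then have "\<exists>P. finite P \<and> P \<subseteq> X \<and> a \<in> L P"
  proof induction
    case one
    show ?case using L_empty by blast
  next
    case (incl h)
    then show ?case by blast
  next
    case (inv h)
    then show ?case using subgroup.m_inv_closed[OF subgroup_L] by blast
  next
    case (eng h1 h2)
    then obtain P Q where PQ: "finite P" "P \<subseteq> X" "h1 \<in> L P" "finite Q" "Q \<subseteq> X" "h2 \<in> L Q"
      by blast
    then have "h1 \<in> L (P \<union> Q)" "h2 \<in> L (P \<union> Q)"
      using L_mono[of P "P \<union> Q"] L_mono[of Q "P \<union> Q"] by auto
    then have "h1 \<otimes>\<^bsub>A\<^esub> h2 \<in> L (P \<union> Q)"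
      using subgroup.m_closed[OF subgroup_L] PQ by blast
    then show ?case using PQ by blast
  qed
  then show thesis using that by blast
qed

lemma finite_common_support:
  assumes "finite F" "F \<subseteq> carrier A"
  obtains P where "finite P" "P \<subseteq> X" "F \<subseteq> L P"
proof -
  have "\<forall>a\<in>F. \<exists>P. finite P \<and> P \<subseteq> X \<and> a \<in> L P"
    using assms(2) finite_support by (metis subsetD)
  then obtain P where P: "\<And>a. a \<in> F \<Longrightarrow> finite (P a) \<and> P a \<subseteq> X \<and> a \<in> L (P a)"
    by metis
  have "F \<subseteq> L (\<Union>a\<in>F. P a)"
  proof
    fix a assume "a \<in> F"
    then have "L (P a) \<subseteq> L (\<Union>a\<in>F. P a)" using P by (intro L_mono) auto
    then show "a \<in> L (\<Union>a\<in>F. P a)" using P[OF \<open>a \<in> F\<close>] by blast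
  qed
  then show thesis using that[of "\<Union>a\<in>F. P a"] P assms(1) by blast
qed

text \<open>An element has some finite support \<open>P\<close>. It remains to delete the finitely many points of
  \<open>P - U\<close> one by one, using that \<open>L\<close> commutes with intersections.\<close>
lemma in_L_if_avoids_complement:
  assumes a: "a \<in> carrier A" and U: "U \<subseteq> X"
    and q: "\<And>q. q \<in> X - U \<Longrightarrow> a \<in> L (X - {q})"
  shows "a \<in> L U"
proof -
  obtain P where P: "finite P" "P \<subseteq> X" "a \<in> L P" using finite_support[OF a] .
  have "finite Q \<Longrightarrow> Q \<subseteq> X - U \<Longrightarrow> a \<in> L (P - Q)" for Q
  proof (induction Q rule: finite_induct)
    case empty
    then show ?case using P by simp
  next
    case (insert x Q)
    then have "a \<in> L (P - Q) \<inter> L (X - {x})" using q by blast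
    moreover have "(P - Q) \<inter> (X - {x}) = P - insert x Q" using P by blast
    ultimately show ?case using L_Int[of "P - Q" "X - {x}"] P by auto
  qed
  from this[of "P - U"] have "a \<in> L (P - (P - U))" using P by blast
  moreover have "P - (P - U) \<subseteq> U" by blast
  ultimately show ?thesis using L_mono U by blast
qed

end

text \<open>Two factorisations differ by an element of \<open>L U \<inter> L V = L {}\<close>.\<close>
lemma (in halo_of_groups) unique_factorisation:
  assumes UV: "U \<subseteq> X" "V \<subseteq> X" "U \<inter> V = {}"
    and e: "e1 \<in> L U" "e2 \<in> L U" and f: "f1 \<in> L V" "f2 \<in> L V"
    and eq: "e1 \<otimes>\<^bsub>A\<^esub> f1 = e2 \<otimes>\<^bsub>A\<^esub> f2"
  shows "e1 = e2"
proof -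
  have c: "e1 \<in> carrier A" "e2 \<in> carrier A" "f1 \<in> carrier A" "f2 \<in> carrier A"
    using e f L_closed UV by auto
  have "inv\<^bsub>A\<^esub> e2 \<otimes>\<^bsub>A\<^esub> e1 = inv\<^bsub>A\<^esub> e2 \<otimes>\<^bsub>A\<^esub> (e1 \<otimes>\<^bsub>A\<^esub> f1) \<otimes>\<^bsub>A\<^esub> inv\<^bsub>A\<^esub> f1"
    using c by (simp add: m_assoc)
  also have "\<dots> = f2 \<otimes>\<^bsub>A\<^esub> inv\<^bsub>A\<^esub> f1"
    unfolding eq using c by (simp add: m_assoc[symmetric])
  finally have "inv\<^bsub>A\<^esub> e2 \<otimes>\<^bsub>A\<^esub> e1 = f2 \<otimes>\<^bsub>A\<^esub> inv\<^bsub>A\<^esub> f1" .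
  moreover have "inv\<^bsub>A\<^esub> e2 \<otimes>\<^bsub>A\<^esub> e1 \<in> L U"
    using e subgroup_L[OF UV(1)] by (simp add: subgroup.m_closed subgroup.m_inv_closed)
  moreover have "f2 \<otimes>\<^bsub>A\<^esub> inv\<^bsub>A\<^esub> f1 \<in> L V"
    using f subgroup_L[OF UV(2)] by (simp add: subgroup.m_closed subgroup.m_inv_closed)
  ultimately have "inv\<^bsub>A\<^esub> e2 \<otimes>\<^bsub>A\<^esub> e1 \<in> L (U \<inter> V)" using L_Int[OF UV(1,2)] by auto
  then have "inv\<^bsub>A\<^esub> e2 \<otimes>\<^bsub>A\<^esub> e1 = \<one>\<^bsub>A\<^esub>" using UV(3) L_empty by simp
  then show ?thesis using c by (metis inv_inv inv_closed inv_equality)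
qed

section \<open>Halo products\<close>

context halo_product_data begin

lemma \<alpha>_auto: "h \<in> carrier H \<Longrightarrow> \<alpha> h \<in> auto A"
  using \<alpha>_hom by (auto simp: hom_def AutoGroup_def)

lemma \<alpha>_closed: "h \<in> carrier H \<Longrightarrow> a \<in> carrier A \<Longrightarrow> \<alpha> h a \<in> carrier A"
  using \<alpha>_auto[of h] by (auto simp: auto_def hom_def)

lemma \<alpha>_mult: "h \<in> carrier H \<Longrightarrow> a \<in> carrier A \<Longrightarrow> b \<in> carrier A \<Longrightarrow>
    \<alpha> h (a \<otimes>\<^bsub>A\<^esub> b) = \<alpha> h a \<otimes>\<^bsub>A\<^esub> \<alpha> h b"
  using \<alpha>_auto[of h] by (auto simp: auto_def hom_def)

lemma group_hom_\<alpha>: "h \<in> carrier H \<Longrightarrow> group_hom A A (\<alpha> h)"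
  using \<alpha>_auto[of h] group_axioms by (simp add: group_hom_def group_hom_axioms_def auto_def)

lemma \<alpha>_one: "h \<in> carrier H \<Longrightarrow> \<alpha> h \<one>\<^bsub>A\<^esub> = \<one>\<^bsub>A\<^esub>"
  by (rule group_hom.hom_one[OF group_hom_\<alpha>])

lemma \<alpha>_inv: "h \<in> carrier H \<Longrightarrow> a \<in> carrier A \<Longrightarrow> \<alpha> h (inv\<^bsub>A\<^esub> a) = inv\<^bsub>A\<^esub> (\<alpha> h a)"
  by (rule group_hom.hom_inv[OF group_hom_\<alpha>])

lemma \<alpha>_comp:
  assumes "h \<in> carrier H" "k \<in> carrier H" "a \<in> carrier A"
  shows "\<alpha> (h \<otimes>\<^bsub>H\<^esub> k) a = \<alpha> h (\<alpha> k a)"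
proof -
  have "\<alpha> (h \<otimes>\<^bsub>H\<^esub> k) = \<alpha> h \<otimes>\<^bsub>AutoGroup A\<^esub> \<alpha> k"
    using \<alpha>_hom assms by (auto simp: hom_def)
  also have "\<dots> = compose (carrier A) (\<alpha> h) (\<alpha> k)"
    using \<alpha>_auto[OF assms(1)] \<alpha>_auto[OF assms(2)] by (simp add: AutoGroup_def BijGroup_def auto_def)
  finally show ?thesis using assms(3) by (simp add: compose_def)
qed

lemma \<alpha>_id:
  assumes "a \<in> carrier A"
  shows "\<alpha> \<one>\<^bsub>H\<^esub> a = a"
proof -
  have "group_hom H (AutoGroup A) \<alpha>"
    using \<alpha>_hom AutoGroup H.group_axioms by (simp add: group_hom_def group_hom_axioms_def)
  then have "\<alpha> \<one>\<^bsub>H\<^esub> = \<one>\<^bsub>AutoGroup A\<^esub>" by (rule group_hom.hom_one)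
  then show ?thesis using assms by (simp add: AutoGroup_def BijGroup_def)
qed

lemma \<alpha>_inv_cancel:
  assumes "h \<in> carrier H" "a \<in> carrier A"
  shows "\<alpha> h (\<alpha> (inv\<^bsub>H\<^esub> h) a) = a" "\<alpha> (inv\<^bsub>H\<^esub> h) (\<alpha> h a) = a"
  using assms \<alpha>_comp[of h "inv\<^bsub>H\<^esub> h" a] \<alpha>_comp[of "inv\<^bsub>H\<^esub> h" h a] \<alpha>_id by auto

abbreviation LH where "LH \<equiv> semidirect_product A H \<alpha>"

lemma LH_simps:
  "carrier LH = carrier A \<times> carrier H"
  "(a, h) \<otimes>\<^bsub>LH\<^esub> (b, k) = (a \<otimes>\<^bsub>A\<^esub> \<alpha> h b, h \<otimes>\<^bsub>H\<^esub> k)"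
  "\<one>\<^bsub>LH\<^esub> = (\<one>\<^bsub>A\<^esub>, \<one>\<^bsub>H\<^esub>)"
  by (auto simp: semidirect_product_def)

lemma group_LH: "group LH"
proof (rule groupI)
  fix x assume x: "x \<in> carrier LH"
  obtain a h where ah: "x = (a, h)" "a \<in> carrier A" "h \<in> carrier H"
    using x by (auto simp: LH_simps)
  then show "\<exists>y\<in>carrier LH. y \<otimes>\<^bsub>LH\<^esub> x = \<one>\<^bsub>LH\<^esub>"
    by (intro bexI[of _ "(\<alpha> (inv\<^bsub>H\<^esub> h) (inv\<^bsub>A\<^esub> a), inv\<^bsub>H\<^esub> h)"])
       (auto simp: LH_simps \<alpha>_closed \<alpha>_mult[symmetric] \<alpha>_one)
qed (auto simp: LH_simps \<alpha>_closed \<alpha>_mult \<alpha>_comp \<alpha>_id m_assoc H.m_assoc)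

lemma inv_mult_LH:
  assumes "a \<in> carrier A" "h \<in> carrier H" "b \<in> carrier A" "k \<in> carrier H"
  shows "inv\<^bsub>LH\<^esub> (a, h) \<otimes>\<^bsub>LH\<^esub> (b, k) = (\<alpha> (inv\<^bsub>H\<^esub> h) (inv\<^bsub>A\<^esub> a \<otimes>\<^bsub>A\<^esub> b), inv\<^bsub>H\<^esub> h \<otimes>\<^bsub>H\<^esub> k)"
proof -
  interpret LH: group LH by (rule group_LH)
  have "(a, h) \<otimes>\<^bsub>LH\<^esub> (\<alpha> (inv\<^bsub>H\<^esub> h) (inv\<^bsub>A\<^esub> a \<otimes>\<^bsub>A\<^esub> b), inv\<^bsub>H\<^esub> h \<otimes>\<^bsub>H\<^esub> k) = (b, k)"
    using assms by (simp add: LH_simps \<alpha>_inv_cancel m_assoc[symmetric] H.m_assoc[symmetric])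
  moreover have "(a, h) \<in> carrier LH" "(b, k) \<in> carrier LH"
     "(\<alpha> (inv\<^bsub>H\<^esub> h) (inv\<^bsub>A\<^esub> a \<otimes>\<^bsub>A\<^esub> b), inv\<^bsub>H\<^esub> h \<otimes>\<^bsub>H\<^esub> k) \<in> carrier LH"
    using assms by (auto simp: LH_simps \<alpha>_closed)
  ultimately show ?thesis
    by (metis LH.inv_solve_left)
qed

end

section \<open>Bounded moves in a finitely generated halo product\<close>

locale fg_halo_product =
  halo_product_data H A L \<alpha> + H: fg_group H T
  for H :: "('h, 'm) monoid_scheme" and A :: "('a, 'n) monoid_scheme"
    and L :: "'h set \<Rightarrow> 'a set" and \<alpha> :: "'h \<Rightarrow> 'a \<Rightarrow> 'a" and T :: "'h set" +
  fixes S :: "('a \<times> 'h) set"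
  assumes fg_LH: "finite_generating_set (semidirect_product A H \<alpha>) S"
    and lf: "locally_finite_group A"

sublocale fg_halo_product \<subseteq> LH: fg_group "semidirect_product A H \<alpha>" S
  using group_LH fg_LH by (simp add: fg_group_def fg_group_axioms_def)

context fg_halo_product begin

abbreviation d where "d \<equiv> word_metric H T"

abbreviation B where "B \<equiv> H.wball"

text \<open>A word changes the colour by an element of this group as long as the arrow stays in the ball of
  radius \<open>r\<close> around \<open>h\<close>. The group is finitely generated, hence finite, and it is supported near \<open>h\<close>. The
  groups \<open>L U\<close> with \<open>U\<close> finite need not be finite: commutators of elements with far-apart supports
  may be supported at a single point. Hence \<open>L\<close> serves to locate supports, and \<open>moves\<close> to bound
  distances.\<close>
definition moves :: "'h \<Rightarrow> real \<Rightarrow> 'a set" where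
  "moves h r = generate A (\<Union>u\<in>B h r. \<alpha> u ` fst ` LH.letters)"

lemma letters_closed: "s \<in> LH.letters \<Longrightarrow> fst s \<in> carrier A \<and> snd s \<in> carrier H"
  using subsetD[OF LH.letters(2), of s] unfolding LH_simps(1) mem_Times_iff by blast

lemma moves_gens: "(\<Union>u\<in>B h r. \<alpha> u ` fst ` LH.letters) \<subseteq> carrier A"
proof (intro UN_least subsetI)
  fix u a assume "u \<in> B h r" "a \<in> \<alpha> u ` fst ` LH.letters"
  then obtain s where "u \<in> carrier H" "s \<in> LH.letters" "a = \<alpha> u (fst s)"
    using H.wball_subset by blast
  then show "a \<in> carrier A" using letters_closed \<alpha>_closed by simp
qed

lemma subgroup_moves: "subgroup (moves h r) A"
  unfolding moves_def by (rule generate_is_subgroup[OF moves_gens])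

lemma moves_closed: "a \<in> moves h r \<Longrightarrow> a \<in> carrier A"
  using subgroup.subset[OF subgroup_moves] by blast

lemma finite_moves: "h \<in> carrier H \<Longrightarrow> finite (moves h r)"
  using lf moves_gens[of h r] H.finite_wball[of h r] LH.letters(1)
  unfolding locally_finite_group_def moves_def by simp

lemma moves_mono:
  assumes "h \<in> carrier H" "k \<in> carrier H" "d k h + r \<le> s"
  shows "moves h r \<subseteq> moves k s"
  unfolding moves_def using H.wball_mono[OF assms] by (intro mono_generate) blast

lemma \<alpha>_moves_gens:
  assumes "h \<in> carrier H" "k \<in> carrier H" "x \<in> (\<Union>u\<in>B h r. \<alpha> u ` fst ` LH.letters)"
  shows "\<alpha> k x \<in> (\<Union>u\<in>B (k \<otimes>\<^bsub>H\<^esub> h) r. \<alpha> u ` fst ` LH.letters)"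
proof -
  obtain u s where us: "u \<in> B h r" "s \<in> LH.letters" "x = \<alpha> u (fst s)"
    using assms(3) by blast
  have u: "u \<in> carrier H" using us(1) H.wball_subset by blast
  have "k \<otimes>\<^bsub>H\<^esub> u \<in> B (k \<otimes>\<^bsub>H\<^esub> h) r"
    using H.left_mult_wball[OF assms(1,2), of r] us(1) by (auto simp: l_coset_def)
  moreover have "\<alpha> k x = \<alpha> (k \<otimes>\<^bsub>H\<^esub> u) (fst s)"
    using us(3) \<alpha>_comp[OF assms(2) u] letters_closed[OF us(2)] by simp
  ultimately show ?thesis using us(2) by blast
qed

lemma \<alpha>_moves:
  assumes "h \<in> carrier H" "k \<in> carrier H" "a \<in> moves h r"
  shows "\<alpha> k a \<in> moves (k \<otimes>\<^bsub>H\<^esub> h) r"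
  using assms(3) unfolding moves_def
proof induction
  case one
  show ?case using assms(2) by (simp add: \<alpha>_one generate.one)
next
  case (incl x)
  then show ?case using \<alpha>_moves_gens[OF assms(1,2)] by (intro generate.incl)
next
  case (inv x)
  moreover have "x \<in> carrier A" using inv moves_gens by blast
  ultimately show ?case
    using \<alpha>_moves_gens[OF assms(1,2) inv] assms(2) \<alpha>_inv[of k x] generate.inv by metis
next
  case (eng x y)
  then have "x \<in> carrier A" "y \<in> carrier A" using moves_closed unfolding moves_def by auto
  then show ?case using eng assms(2) by (simp add: \<alpha>_mult generate.eng)
qed

lemma moves_support:
  obtains m where "0 \<le> m" "\<And>h r. h \<in> carrier H \<Longrightarrow> moves h r \<subseteq> L (B h (r + m))"
proof -
  have "finite (fst ` LH.letters)" "fst ` LH.letters \<subseteq> carrier A"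
    using LH.letters(1) letters_closed by auto
  then obtain P where P: "finite P" "P \<subseteq> carrier H" "fst ` LH.letters \<subseteq> L P"
    by (rule finite_common_support)
  define m where "m = real (Max (insert 0 (H.len ` P)))"
  have m: "real (H.len p) \<le> m" if "p \<in> P" for p
    unfolding m_def using P(1) that by simp
  have "moves h r \<subseteq> L (B h (r + m))" if h: "h \<in> carrier H" for h r
    unfolding moves_def
  proof (rule generate_subgroup_incl[OF _ subgroup_L[OF H.wball_subset]], intro UN_least subsetI)
    fix u x assume u: "u \<in> B h r" and "x \<in> \<alpha> u ` fst ` LH.letters"
    then obtain s where s: "s \<in> LH.letters" and x: "x = \<alpha> u (fst s)" by blast
    have uH: "u \<in> carrier H" using u H.wball_subset by blast
    have "u <#\<^bsub>H\<^esub> P \<subseteq> B h (r + m)"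
    proof
      fix x assume "x \<in> u <#\<^bsub>H\<^esub> P"
      then obtain p where p: "p \<in> P" "x = u \<otimes>\<^bsub>H\<^esub> p" by (auto simp: l_coset_def)
      have "d h x \<le> d h u + d u x" using h uH p P by (intro H.wd_triangle) auto
      moreover have "d u x = H.len p" using p P uH H.wd_mult_right by auto
      moreover have "d h u \<le> r" using u by (simp add: H.wball_def)
      ultimately show "x \<in> B h (r + m)" using m[OF p(1)] p P uH by (auto simp: H.wball_def)
    qed
    then have "L (u <#\<^bsub>H\<^esub> P) \<subseteq> L (B h (r + m))" using H.wball_subset by (rule L_mono)
    moreover have "\<alpha> u (fst s) \<in> L (u <#\<^bsub>H\<^esub> P)" using \<alpha>_L[OF uH P(2)] P(3) s by blast
    ultimately show "x \<in> L (B h (r + m))" unfolding x by blast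
  qed
  moreover have "0 \<le> m" by (simp add: m_def)
  ultimately show thesis using that by blast
qed

text \<open>Read a word from \<open>(a, h)\<close> to \<open>(b, k)\<close> letter by letter: a letter \<open>(f, t)\<close> read with arrow at
  \<open>u\<close> multiplies the colour by \<open>\<alpha> u f\<close> and moves the arrow by at most the length of \<open>t\<close>, which is
  bounded by \<open>\<kappa>\<close>.\<close>
lemma displacement:
  obtains \<kappa> where "0 \<le> \<kappa>"
    "\<And>a h b k. (a, h) \<in> carrier LH \<Longrightarrow> (b, k) \<in> carrier LH \<Longrightarrow>
       d h k \<le> \<kappa> * word_metric LH S (a, h) (b, k) \<and>
       inv\<^bsub>A\<^esub> a \<otimes>\<^bsub>A\<^esub> b \<in> moves h (\<kappa> * word_metric LH S (a, h) (b, k))"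
proof -
  define \<kappa> where "\<kappa> = real (Max (insert 0 ((\<lambda>s. H.len (snd s)) ` LH.letters)))"
  have \<kappa>: "real (H.len (snd s)) \<le> \<kappa>" if "s \<in> LH.letters" for s
    unfolding \<kappa>_def of_nat_le_iff using LH.letters(1) that by (intro Max_ge) auto
  have k0: "0 \<le> \<kappa>" by (simp add: \<kappa>_def)
  have word: "d h k \<le> \<kappa> * length ws \<and> inv\<^bsub>A\<^esub> a \<otimes>\<^bsub>A\<^esub> b \<in> moves h (\<kappa> * length ws)"
    if "set ws \<subseteq> LH.letters" "(a, h) \<in> carrier LH"
      "(b, k) = (a, h) \<otimes>\<^bsub>LH\<^esub> foldr (\<lambda>x y. x \<otimes>\<^bsub>LH\<^esub> y) ws \<one>\<^bsub>LH\<^esub>" for ws a h b k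
    using that
  proof (induction ws arbitrary: a h)
    case Nil
    then have "a \<in> carrier A" "h \<in> carrier H" "b = a" "k = h"
      by (auto simp: LH_simps \<alpha>_one)
    then show ?case using H.wd_self subgroup.one_closed[OF subgroup_moves] by simp
  next
    case (Cons s ws)
    obtain f t where s: "s = (f, t)" by (cases s)
    have ah: "a \<in> carrier A" "h \<in> carrier H" and ft: "f \<in> carrier A" "t \<in> carrier H"
      using Cons.prems letters_closed[of s] s by (auto simp: LH_simps)
    have sC: "s \<in> carrier LH" using Cons.prems(1) LH.letters(2) by auto
    define a' h' where "a' = a \<otimes>\<^bsub>A\<^esub> \<alpha> h f" and "h' = h \<otimes>\<^bsub>H\<^esub> t"
    have a'h': "a' \<in> carrier A" "h' \<in> carrier H" unfolding a'_def h'_def using ah ft \<alpha>_closed by auto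
    have cl: "foldr (\<lambda>x y. x \<otimes>\<^bsub>LH\<^esub> y) ws \<one>\<^bsub>LH\<^esub> \<in> carrier LH"
      using Cons.prems(1) LH.letters(2) by (intro LH.foldr_mult_closed) auto
    have "(b, k) = ((a, h) \<otimes>\<^bsub>LH\<^esub> s) \<otimes>\<^bsub>LH\<^esub> foldr (\<lambda>x y. x \<otimes>\<^bsub>LH\<^esub> y) ws \<one>\<^bsub>LH\<^esub>"
      using Cons.prems(2,3) sC cl by (simp add: LH.m_assoc)
    also have "(a, h) \<otimes>\<^bsub>LH\<^esub> s = (a', h')" by (simp add: s LH_simps a'_def h'_def)
    finally have IH: "d h' k \<le> \<kappa> * length ws" "inv\<^bsub>A\<^esub> a' \<otimes>\<^bsub>A\<^esub> b \<in> moves h' (\<kappa> * length ws)"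
      and eq: "(b, k) = (a', h') \<otimes>\<^bsub>LH\<^esub> foldr (\<lambda>x y. x \<otimes>\<^bsub>LH\<^esub> y) ws \<one>\<^bsub>LH\<^esub>"
      using Cons.IH[of a' h'] Cons.prems(1) a'h' by (auto simp: LH_simps(1))
    have "(b, k) \<in> carrier LH"
      unfolding eq using cl a'h' by (intro LH.m_closed) (auto simp: LH_simps(1))
    then have bk: "b \<in> carrier A" "k \<in> carrier H" by (auto simp: LH_simps)
    have dh: "d h h' \<le> \<kappa>"
      using \<kappa>[of s] Cons.prems(1) s ah ft unfolding h'_def by (simp add: H.wd_mult_right)
    have "d h k \<le> d h h' + d h' k" using ah a'h' bk by (intro H.wd_triangle)
    then have 1: "d h k \<le> \<kappa> * length (s # ws)" using dh IH(1) by (simp add: algebra_simps)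
    have "moves h' (\<kappa> * length ws) \<subseteq> moves h (\<kappa> * length (s # ws))"
      using dh ah a'h' by (intro moves_mono) (auto simp: algebra_simps)
    then have "inv\<^bsub>A\<^esub> a' \<otimes>\<^bsub>A\<^esub> b \<in> moves h (\<kappa> * length (s # ws))" using IH(2) by blast
    moreover have "\<alpha> h f \<in> moves h (\<kappa> * length (s # ws))"
      unfolding moves_def
    proof (intro generate.incl UN_I[of h] imageI)
      show "h \<in> B h (\<kappa> * length (s # ws))" using ah k0 by (simp add: H.wball_def H.wd_self)
      show "f \<in> fst ` LH.letters" using Cons.prems(1) s by (intro image_eqI[of _ _ s]) auto
    qed
    ultimately have "\<alpha> h f \<otimes>\<^bsub>A\<^esub> (inv\<^bsub>A\<^esub> a' \<otimes>\<^bsub>A\<^esub> b) \<in> moves h (\<kappa> * length (s # ws))"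
      using subgroup.m_closed[OF subgroup_moves] by blast
    moreover have "\<alpha> h f \<otimes>\<^bsub>A\<^esub> (inv\<^bsub>A\<^esub> a' \<otimes>\<^bsub>A\<^esub> b) = inv\<^bsub>A\<^esub> a \<otimes>\<^bsub>A\<^esub> b"
      unfolding a'_def using ah ft bk \<alpha>_closed[OF ah(2) ft(1)]
      by (simp add: inv_mult_group m_assoc[symmetric])
    ultimately show ?case using 1 by simp
  qed
  show thesis
  proof (rule that[OF k0])
    fix a h b k assume g: "(a, h) \<in> carrier LH" "(b, k) \<in> carrier LH"
    define e where "e = inv\<^bsub>LH\<^esub> (a, h) \<otimes>\<^bsub>LH\<^esub> (b, k)"
    have e: "e \<in> carrier LH" "(b, k) = (a, h) \<otimes>\<^bsub>LH\<^esub> e"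
      unfolding e_def using g by (simp_all add: LH.m_assoc[symmetric])
    obtain ws where ws: "length ws = LH.len e" "set ws \<subseteq> LH.letters"
        "foldr (\<lambda>x y. x \<otimes>\<^bsub>LH\<^esub> y) ws \<one>\<^bsub>LH\<^esub> = e"
      using LH.shortest_word[OF e(1)] .
    then show "d h k \<le> \<kappa> * word_metric LH S (a, h) (b, k) \<and>
       inv\<^bsub>A\<^esub> a \<otimes>\<^bsub>A\<^esub> b \<in> moves h (\<kappa> * word_metric LH S (a, h) (b, k))"
      using word[OF ws(2) g(1), of b k] e(2) unfolding word_metric_def e_def[symmetric] by simp
  qed
qed

text \<open>After translating the arrow \<open>h\<close> to the identity only finitely many relative positions remain.\<close>
lemma bounded_distance:
  assumes "finite E"
  obtains w where
    "\<And>a h b k. a \<in> carrier A \<Longrightarrow> h \<in> carrier H \<Longrightarrow> b \<in> carrier A \<Longrightarrow> k \<in> carrier H \<Longrightarrow>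
       \<alpha> (inv\<^bsub>H\<^esub> h) (inv\<^bsub>A\<^esub> a \<otimes>\<^bsub>A\<^esub> b) \<in> E \<Longrightarrow> d h k \<le> r \<Longrightarrow> word_metric LH S (a, h) (b, k) \<le> w"
proof -
  define N where "N = E \<times> B \<one>\<^bsub>H\<^esub> r"
  have N: "finite N" unfolding N_def using assms H.finite_wball[of "\<one>\<^bsub>H\<^esub>"] by simp
  have "word_metric LH S (a, h) (b, k) \<le> real (Max (LH.len ` N))"
    if g: "a \<in> carrier A" "h \<in> carrier H" "b \<in> carrier A" "k \<in> carrier H"
       "\<alpha> (inv\<^bsub>H\<^esub> h) (inv\<^bsub>A\<^esub> a \<otimes>\<^bsub>A\<^esub> b) \<in> E" "d h k \<le> r" for a h b k
  proof -
    have "inv\<^bsub>H\<^esub> h \<otimes>\<^bsub>H\<^esub> k \<in> B \<one>\<^bsub>H\<^esub> r"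
      using g unfolding H.wball_def by (simp add: word_metric_def)
    then have "inv\<^bsub>LH\<^esub> (a, h) \<otimes>\<^bsub>LH\<^esub> (b, k) \<in> N"
      using g inv_mult_LH[of a h b k] by (simp add: N_def)
    then show ?thesis unfolding word_metric_def using N by simp
  qed
  then show thesis using that by blast
qed

end

context fg_halo_product begin

lemma \<alpha>_L_wball:
  assumes "k \<in> carrier H" "h \<in> carrier H" "a \<in> L (B h r)"
  shows "\<alpha> k a \<in> L (B (k \<otimes>\<^bsub>H\<^esub> h) r)"
proof -
  have "\<alpha> k a \<in> L (k <#\<^bsub>H\<^esub> B h r)"
    using \<alpha>_L[OF assms(1) H.wball_subset] assms(3) by blast
  then show ?thesis
    using L_mono[OF H.left_mult_wball[OF assms(2,1)] H.wball_subset] by blast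
qed

lemma set_distance_wball:
  assumes "h \<in> carrier H" "k \<in> carrier H" "K + 2 * s \<le> d h k" "x \<in> B h s" "y \<in> B k s"
  shows "K \<le> d x y"
proof -
  have xy: "x \<in> carrier H" "y \<in> carrier H" "d h x \<le> s" "d k y \<le> s"
    using assms by (auto simp: H.wball_def)
  have "d h k \<le> d h x + d x k" "d x k \<le> d x y + d y k"
    using assms xy by (auto intro: H.wd_triangle)
  then show ?thesis using xy assms H.wd_sym[of y k] by simp
qed

text \<open>Colours near the identity which some colour \<open>f\<close> with support in a disjoint ball completes
  to an element of a fixed finite group of moves. Although \<open>L\<close> of a ball may be infinite, these
  form a finite set: the centre \<open>k\<close> of the disjoint ball and the product \<open>e f\<close> take finitely many
  values, and they determine \<open>e\<close> by uniqueness of factorisations.\<close>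
definition rigid_colours :: "real \<Rightarrow> real \<Rightarrow> 'a set" where
  "rigid_colours s r = {e \<in> L (B \<one>\<^bsub>H\<^esub> s). \<exists>k \<in> B \<one>\<^bsub>H\<^esub> r. B k s \<inter> B \<one>\<^bsub>H\<^esub> s = {} \<and>
     (\<exists>f \<in> L (B k s). e \<otimes>\<^bsub>A\<^esub> f \<in> moves \<one>\<^bsub>H\<^esub> r)}"

lemma finite_rigid_colours: "finite (rigid_colours s r)"
proof -
  \<comment> \<open>the elements with given centre \<open>k\<close> and given product \<open>l\<close>: at most one\<close>
  define E where "E k l = {e \<in> L (B \<one>\<^bsub>H\<^esub> s). B k s \<inter> B \<one>\<^bsub>H\<^esub> s = {} \<and> (\<exists>f \<in> L (B k s). e \<otimes>\<^bsub>A\<^esub> f = l)}"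
    for k l
  have "finite (E k l)" for k l
  proof (rule finite_subset)
    show "E k l \<subseteq> {SOME e. e \<in> E k l}"
    proof
      fix e assume e: "e \<in> E k l"
      then have e': "(SOME e. e \<in> E k l) \<in> E k l" by (rule someI[of "\<lambda>e. e \<in> E k l"])
      have "e1 = e2" if mem: "e1 \<in> E k l" "e2 \<in> E k l" for e1 e2
      proof -
        obtain f1 where 1: "e1 \<in> L (B \<one>\<^bsub>H\<^esub> s)" "B \<one>\<^bsub>H\<^esub> s \<inter> B k s = {}" "f1 \<in> L (B k s)"
            "e1 \<otimes>\<^bsub>A\<^esub> f1 = l"
          using mem(1) unfolding E_def by blast
        obtain f2 where 2: "e2 \<in> L (B \<one>\<^bsub>H\<^esub> s)" "f2 \<in> L (B k s)" "e2 \<otimes>\<^bsub>A\<^esub> f2 = l"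
          using mem(2) unfolding E_def by blast
        show ?thesis
          using unique_factorisation[OF H.wball_subset H.wball_subset 1(2,1) 2(1) 1(3) 2(2)] 1(4) 2(3)
          by simp
      qed
      then have "e = (SOME e. e \<in> E k l)" using e e' by blast
      then show "e \<in> {SOME e. e \<in> E k l}" by simp
    qed
  qed simp
  then have "finite (\<Union>k\<in>B \<one>\<^bsub>H\<^esub> r. \<Union>l\<in>moves \<one>\<^bsub>H\<^esub> r. E k l)"
    using H.finite_wball finite_moves by simp
  moreover have "rigid_colours s r \<subseteq> (\<Union>k\<in>B \<one>\<^bsub>H\<^esub> r. \<Union>l\<in>moves \<one>\<^bsub>H\<^esub> r. E k l)"
    unfolding rigid_colours_def E_def by blast
  ultimately show ?thesis by (rule finite_subset[rotated])
qed

end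

section \<open>Coarsely controlled maps into a halo product\<close>

text \<open>The coordinates of a map \<open>z \<mapsto> (a z, h z)\<close> from \<open>Z\<close> to the halo product sending points at
  distance at most \<open>C0\<close> to points joined by a bounded word.\<close>
locale coarse_map = fg_halo_product H A L \<alpha> T S
  for H :: "('h, 'm) monoid_scheme" and A :: "('a, 'n) monoid_scheme"
    and L :: "'h set \<Rightarrow> 'a set" and \<alpha> :: "'h \<Rightarrow> 'a \<Rightarrow> 'a" and T :: "'h set"
    and S :: "('a \<times> 'h) set" +
  fixes Z :: "'z::metric_space set" and a :: "'z \<Rightarrow> 'a" and h :: "'z \<Rightarrow> 'h"
    and C0 r0 :: real
  assumes C0: "0 < C0" and r0: "0 \<le> r0"
    and a [simp]: "z \<in> Z \<Longrightarrow> a z \<in> carrier A"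
    and h [simp]: "z \<in> Z \<Longrightarrow> h z \<in> carrier H"
    and controlled: "z \<in> Z \<Longrightarrow> z' \<in> Z \<Longrightarrow> dist z z' \<le> C0 \<Longrightarrow>
      d (h z) (h z') \<le> r0 \<and> inv\<^bsub>A\<^esub> a z \<otimes>\<^bsub>A\<^esub> a z' \<in> moves (h z) r0"
begin

lemma change_trans:
  "x \<in> Z \<Longrightarrow> y \<in> Z \<Longrightarrow> z \<in> Z \<Longrightarrow>
    (inv\<^bsub>A\<^esub> a x \<otimes>\<^bsub>A\<^esub> a y) \<otimes>\<^bsub>A\<^esub> (inv\<^bsub>A\<^esub> a y \<otimes>\<^bsub>A\<^esub> a z) = inv\<^bsub>A\<^esub> a x \<otimes>\<^bsub>A\<^esub> a z"
  by (metis a inv_closed inv_solve_left m_assoc m_closed)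

text \<open>Follow \<open>g\<close> in small steps until the arrow first leaves the ball of radius \<open>D\<close> around \<open>h x\<close>.
  Up to that moment the colour was only changed near that ball. If the arrow never leaves the
  ball, this holds until \<open>y\<close> is reached.\<close>
lemma escape:
  assumes g: "path_between Z x y g" and D: "0 \<le> D"
    and no: "\<not> (\<exists>z\<in>Z. D < d (h x) (h z) \<and> d (h x) (h z) \<le> D + r0 \<and>
                inv\<^bsub>A\<^esub> a x \<otimes>\<^bsub>A\<^esub> a z \<in> moves (h x) (D + r0))"
  shows "d (h x) (h y) \<le> D \<and> inv\<^bsub>A\<^esub> a x \<otimes>\<^bsub>A\<^esub> a y \<in> moves (h x) (D + r0)"
proof -
  have g': "path g" "path_image g \<subseteq> Z" "g 0 = x" "g 1 = y"
    using g unfolding path_between_def pathstart_def pathfinish_def by auto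
  have gZ: "g t \<in> Z" if "t \<in> {0..1}" for t using g'(2) that by (auto simp: path_image_def)
  obtain n :: nat where n: "0 < n"
    and fine: "\<And>t t'. t \<in> {0..1} \<Longrightarrow> t' \<in> {0..1} \<Longrightarrow> \<bar>t - t'\<bar> \<le> 2 / n \<Longrightarrow> dist (g t) (g t') \<le> C0"
    using path_fine[OF g'(1) C0] by metis
  have x: "x \<in> Z" using gZ[of 0] g' by simp
  have "i \<le> n \<Longrightarrow> d (h x) (h (g (i / n))) \<le> D \<and>
      inv\<^bsub>A\<^esub> a x \<otimes>\<^bsub>A\<^esub> a (g (i / n)) \<in> moves (h x) (D + r0)" for i :: nat
  proof (induction i)
    case 0
    then show ?case using g' x D H.wd_self subgroup.one_closed[OF subgroup_moves] by simp
  next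
    case (Suc i)
    let ?z = "g (i / n)" and ?w = "g (Suc i / n)"
    have I: "real i / n \<in> {0..1}" "real (Suc i) / n \<in> {0..1}"
      using Suc.prems n by (auto simp: divide_le_eq_1)
    have zw: "?z \<in> Z" "?w \<in> Z" using gZ I by auto
    have IH: "d (h x) (h ?z) \<le> D" "inv\<^bsub>A\<^esub> a x \<otimes>\<^bsub>A\<^esub> a ?z \<in> moves (h x) (D + r0)"
      using Suc by auto
    have "\<bar>real i / n - real (Suc i) / n\<bar> \<le> 2 / n" using n by (simp add: field_simps)
    then have c: "d (h ?z) (h ?w) \<le> r0" "inv\<^bsub>A\<^esub> a ?z \<otimes>\<^bsub>A\<^esub> a ?w \<in> moves (h ?z) r0"
      using controlled[OF zw fine[OF I]] by auto
    have "moves (h ?z) r0 \<subseteq> moves (h x) (D + r0)"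
      using x zw IH by (intro moves_mono) auto
    then have "(inv\<^bsub>A\<^esub> a x \<otimes>\<^bsub>A\<^esub> a ?z) \<otimes>\<^bsub>A\<^esub> (inv\<^bsub>A\<^esub> a ?z \<otimes>\<^bsub>A\<^esub> a ?w) \<in> moves (h x) (D + r0)"
      using IH(2) c(2) subgroup.m_closed[OF subgroup_moves] by blast
    then have 1: "inv\<^bsub>A\<^esub> a x \<otimes>\<^bsub>A\<^esub> a ?w \<in> moves (h x) (D + r0)"
      using change_trans[OF x zw] by simp
    have "d (h x) (h ?w) \<le> d (h x) (h ?z) + d (h ?z) (h ?w)"
      using x zw by (intro H.wd_triangle) auto
    then have "d (h x) (h ?w) \<le> D + r0" using IH c by simp
    then show ?case using 1 no zw(2) by force
  qed
  from this[of n] show ?thesis using n g' by simp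
qed

text \<open>A point \<open>q\<close> far from \<open>h x\<close> and \<open>h y\<close> can be removed from the support. Label
  a point of \<open>Z\<close> whose arrow is near \<open>q\<close> by its colour modulo
  moves near \<open>q\<close>, and any other point by its colour modulo \<open>L\<close> of the complement of \<open>q\<close>. The
  points sharing a label near \<open>q\<close> lie in a set of diameter at most \<open>R\<close>, so the thick bigon
  condition provides a homotopic path avoiding that label. Hence \<open>x\<close> and \<open>y\<close> have the same label.
  The tree of reduced walks between labels plays the role of the Bass-Serre tree of the
  amalgam of colour changes near \<open>q\<close> with colour changes away from \<open>q\<close>.\<close>
lemma change_supported_near_ends:
  assumes C: "C \<le> C0" and xy: "x \<in> Z" "y \<in> Z"
    and supp: "\<And>k. k \<in> carrier H \<Longrightarrow> moves k r0 \<subseteq> L (B k r1)" and r1: "r0 \<le> r1"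
    and near: "\<And>p p' q. p \<in> Z \<Longrightarrow> p' \<in> Z \<Longrightarrow> q \<in> carrier H \<Longrightarrow> d q (h p) \<le> r1 \<Longrightarrow> d q (h p') \<le> r1 \<Longrightarrow>
       inv\<^bsub>A\<^esub> a p \<otimes>\<^bsub>A\<^esub> a p' \<in> moves q (r0 + r1) \<Longrightarrow> dist p p' \<le> R"
    and ends: "\<And>z z'. z \<in> Z \<Longrightarrow> z' \<in> Z \<Longrightarrow> dist z z' \<le> M \<Longrightarrow> d (h z) (h z') \<le> r2" and r2: "0 \<le> r2"
    and g: "path_between Z x y g"
    and thick: "\<And>p. p \<in> path_image g \<Longrightarrow> dist x p \<ge> M \<Longrightarrow> dist y p \<ge> M \<Longrightarrow>
       \<exists>g'. path_between Z x y g' \<and> coarsely_homotopic Z C g g' \<and> path_image g' \<inter> cball p R = {}"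
  shows "inv\<^bsub>A\<^esub> a x \<otimes>\<^bsub>A\<^esub> a y \<in> L (B (h x) (r1 + r2) \<union> B (h y) (r1 + r2))"
proof (rule in_L_if_avoids_complement)
  show "inv\<^bsub>A\<^esub> a x \<otimes>\<^bsub>A\<^esub> a y \<in> carrier A" using xy by simp
  show "B (h x) (r1 + r2) \<union> B (h y) (r1 + r2) \<subseteq> carrier H" using H.wball_subset by blast
  fix q assume "q \<in> carrier H - (B (h x) (r1 + r2) \<union> B (h y) (r1 + r2))"
  then have q: "q \<in> carrier H" "d (h x) q > r1 + r2" "d (h y) q > r1 + r2"
    by (auto simp: H.wball_def)
  define N where "N = L (carrier H - {q})"
  have N: "subgroup N A" unfolding N_def by (rule subgroup_L) blast
  define P where "P = moves q (r0 + r1)"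
  have P: "subgroup P A" unfolding P_def by (rule subgroup_moves)
  define V where "V z = (if d q (h z) \<le> r1 then (True, a z <#\<^bsub>A\<^esub> P) else (False, a z <#\<^bsub>A\<^esub> N))" for z
  have "locally_compatible Z C0 V"
    unfolding locally_compatible_def
  proof (intro ballI impI)
    fix z z' assume z: "z \<in> Z" "z' \<in> Z" and dz: "dist z z' \<le> C0"
    have ch: "inv\<^bsub>A\<^esub> a z \<otimes>\<^bsub>A\<^esub> a z' \<in> moves (h z) r0" using controlled[OF z dz] by simp
    have "a z <#\<^bsub>A\<^esub> P = a z' <#\<^bsub>A\<^esub> P" if "d q (h z) \<le> r1"
    proof -
      have "moves (h z) r0 \<subseteq> P"
        unfolding P_def using that z q by (intro moves_mono) auto
      then show ?thesis using lcos_eq_iff[OF P] z ch by auto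
    qed
    moreover have "a z <#\<^bsub>A\<^esub> N = a z' <#\<^bsub>A\<^esub> N" if "\<not> d q (h z) \<le> r1"
    proof -
      have "L (B (h z) r1) \<subseteq> N"
        unfolding N_def using that z q H.wd_sym by (intro L_mono) (auto simp: H.wball_def)
      then show ?thesis using lcos_eq_iff[OF N] z ch supp[of "h z"] by auto
    qed
    ultimately show "compatible (V z) (V z')" unfolding compatible_def V_def by auto
  qed
  moreover have "\<exists>g'. path_between Z x y g' \<and> coarsely_homotopic Z C g g' \<and> V p \<notin> V ` path_image g'"
    if p: "p \<in> path_image g" "fst (V p)" for p
  proof -
    have pZ: "p \<in> Z" using p(1) g unfolding path_between_def by blast
    have dp: "d q (h p) \<le> r1" using p(2) unfolding V_def by (auto split: if_splits)
    have far: "dist z p \<ge> M" if z: "z \<in> Z" "d (h z) q > r1 + r2" for z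
    proof (rule ccontr)
      assume "\<not> dist z p \<ge> M"
      then have "d (h z) (h p) \<le> r2" using ends[of z p] z pZ by simp
      moreover have "d (h z) q \<le> d (h z) (h p) + d (h p) q"
        using z pZ q by (intro H.wd_triangle) auto
      ultimately show False using z dp H.wd_sym[of q "h p"] pZ q by simp
    qed
    obtain g' where g': "path_between Z x y g'" "coarsely_homotopic Z C g g'" "path_image g' \<inter> cball p R = {}"
      using thick[OF p(1) far far] xy q by blast
    have "V p \<noteq> V p'" if p': "p' \<in> path_image g'" for p'
    proof
      assume eq: "V p = V p'"
      have p'Z: "p' \<in> Z" using p' g'(1) unfolding path_between_def by blast
      have dp': "d q (h p') \<le> r1" using eq dp unfolding V_def by (auto split: if_splits)
      have "a p <#\<^bsub>A\<^esub> P = a p' <#\<^bsub>A\<^esub> P" using eq dp dp' unfolding V_def by simp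
      then have "inv\<^bsub>A\<^esub> a p \<otimes>\<^bsub>A\<^esub> a p' \<in> P" using lcos_eq_iff[OF P] pZ p'Z by simp
      then have "dist p p' \<le> R" using near[OF pZ p'Z q(1) dp dp'] unfolding P_def by simp
      then show False using g'(3) p' by auto
    qed
    then show ?thesis using g' by blast
  qed
  ultimately have "V x = V y" using avoidable_vertices_imp_same_class[OF _ C0 C g] by blast
  moreover have "\<not> d q (h x) \<le> r1" using H.wd_sym[of q "h x"] q xy r2 by simp
  ultimately have "a x <#\<^bsub>A\<^esub> N = a y <#\<^bsub>A\<^esub> N" unfolding V_def by (auto split: if_splits)
  then show "inv\<^bsub>A\<^esub> a x \<otimes>\<^bsub>A\<^esub> a y \<in> L (carrier H - {q})"
    using lcos_eq_iff[OF N] xy unfolding N_def by simp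
qed

end

context coarse_map begin

text \<open>If \<open>z\<close> and \<open>w\<close> both differ from \<open>c\<close> near their own arrows only, and the arrows are far enough apart
  for the two supports to be disjoint, then the move from \<open>z\<close> to \<open>w\<close> factors as the change from
  \<open>z\<close> to \<open>c\<close> followed by the change from \<open>c\<close> to \<open>w\<close>.\<close>
lemma colour_in_rigid_colours:
  assumes s: "0 \<le> s" and z: "z \<in> Z" "w \<in> Z" and c: "c \<in> carrier A"
    and dzw: "2 * s < d (h z) (h w)" "d (h z) (h w) \<le> 2 * s + r0"
    and zw: "inv\<^bsub>A\<^esub> a z \<otimes>\<^bsub>A\<^esub> a w \<in> moves (h z) (2 * s + r0)"
    and cz: "inv\<^bsub>A\<^esub> a z \<otimes>\<^bsub>A\<^esub> c \<in> L (B (h z) s)"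
    and cw: "inv\<^bsub>A\<^esub> a w \<otimes>\<^bsub>A\<^esub> c \<in> L (B (h w) s)"
  shows "\<alpha> (inv\<^bsub>H\<^esub> h z) (inv\<^bsub>A\<^esub> a z \<otimes>\<^bsub>A\<^esub> c) \<in> rigid_colours s (2 * s + r0)"
proof -
  define i where "i = inv\<^bsub>H\<^esub> h z"
  define k where "k = i \<otimes>\<^bsub>H\<^esub> h w"
  have i: "i \<in> carrier H" "i \<otimes>\<^bsub>H\<^esub> h z = \<one>\<^bsub>H\<^esub>" and k: "k \<in> carrier H"
    using z unfolding i_def k_def by auto
  have dk: "d \<one>\<^bsub>H\<^esub> k = d (h z) (h w)"
    using H.wd_left_mult[of "h z" "h w" i] i z unfolding k_def by simp
  have disj: "B k s \<inter> B \<one>\<^bsub>H\<^esub> s = {}"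
  proof (rule ccontr)
    assume "B k s \<inter> B \<one>\<^bsub>H\<^esub> s \<noteq> {}"
    then obtain u where u: "u \<in> carrier H" "d k u \<le> s" "d \<one>\<^bsub>H\<^esub> u \<le> s"
      by (auto simp: H.wball_def)
    then have "d \<one>\<^bsub>H\<^esub> k \<le> 2 * s"
      using H.wd_triangle[of "\<one>\<^bsub>H\<^esub>" u k] H.wd_sym[of k u] k by simp
    then show False using dk dzw by simp
  qed
  let ?e = "inv\<^bsub>A\<^esub> a z \<otimes>\<^bsub>A\<^esub> c" and ?f = "inv\<^bsub>A\<^esub> (inv\<^bsub>A\<^esub> a w \<otimes>\<^bsub>A\<^esub> c)"
  have e: "?e \<in> carrier A" "?f \<in> carrier A" using z c by auto
  have "?f \<in> L (B (h w) s)"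
    using subgroup.m_inv_closed[OF subgroup_L[OF H.wball_subset] cw] .
  then have f: "\<alpha> i ?f \<in> L (B k s)" unfolding k_def using i z by (intro \<alpha>_L_wball) auto
  have "?e \<otimes>\<^bsub>A\<^esub> ?f = inv\<^bsub>A\<^esub> a z \<otimes>\<^bsub>A\<^esub> a w"
    using z c by (simp add: inv_mult_group m_assoc) (simp add: m_assoc[symmetric])
  then have "\<alpha> i (?e \<otimes>\<^bsub>A\<^esub> ?f) \<in> moves \<one>\<^bsub>H\<^esub> (2 * s + r0)"
    using \<alpha>_moves[of "h z" i, OF _ i(1) zw] i(2) z by simp
  then have "\<alpha> i ?e \<otimes>\<^bsub>A\<^esub> \<alpha> i ?f \<in> moves \<one>\<^bsub>H\<^esub> (2 * s + r0)"
    using e i by (simp add: \<alpha>_mult)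
  moreover have "\<alpha> i ?e \<in> L (B \<one>\<^bsub>H\<^esub> s)"
    using \<alpha>_L_wball[of i "h z", OF i(1) _ cz] i(2) z by simp
  moreover have "k \<in> B \<one>\<^bsub>H\<^esub> (2 * s + r0)" using k dk dzw by (simp add: H.wball_def)
  ultimately show ?thesis using disj f unfolding rigid_colours_def i_def[symmetric] by blast
qed

text \<open>If the arrows stay in a bounded set, then so does the map. Otherwise there are three points
  \<open>x, y, w\<close> with arrows far apart. Passing through \<open>w\<close> and using fullness, the change from \<open>x\<close> to
  \<open>y\<close> is a product \<open>l m\<close> with \<open>l\<close> supported near \<open>h x\<close> and \<open>m\<close> near \<open>h y\<close>; put \<open>c = a x l\<close>. For
  any \<open>z\<close>, the change from \<open>z\<close> to \<open>c\<close> through \<open>x\<close> is supported near \<open>h z\<close> and \<open>h x\<close>, and the one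
  through \<open>y\<close> near \<open>h z\<close> and \<open>h y\<close>. Both are the same element, so it is supported near \<open>h z\<close> alone;
  as the arrow can escape from \<open>h z\<close>, it is one of the finitely many rigid colours.\<close>
lemma common_coset:
  assumes ne: "x0 \<in> Z" and conn: "\<And>x y. x \<in> Z \<Longrightarrow> y \<in> Z \<Longrightarrow> \<exists>g. path_between Z x y g"
    and s: "0 \<le> s" and K: "0 \<le> K" and D: "D = 2 * (K + 2 * s) + r0"
    and pair: "\<And>x y. x \<in> Z \<Longrightarrow> y \<in> Z \<Longrightarrow> inv\<^bsub>A\<^esub> a x \<otimes>\<^bsub>A\<^esub> a y \<in> L (B (h x) s \<union> B (h y) s)"
    and full: "\<And>P Q R U. P \<subseteq> carrier H \<Longrightarrow> Q \<subseteq> carrier H \<Longrightarrow> R \<subseteq> carrier H \<Longrightarrow> U \<subseteq> carrier H \<Longrightarrow>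
        set_distance d P Q \<ge> ereal K \<Longrightarrow> set_distance d P R \<ge> ereal K \<Longrightarrow>
        set_distance d P U \<ge> ereal K \<Longrightarrow> set_distance d Q R \<ge> ereal K \<Longrightarrow>
        (L (P \<union> Q) <#>\<^bsub>A\<^esub> L U) \<inter> L (P \<union> R) \<subseteq> L P <#>\<^bsub>A\<^esub> L R"
  shows "\<exists>c\<in>carrier A. \<forall>z\<in>Z. \<alpha> (inv\<^bsub>H\<^esub> h z) (inv\<^bsub>A\<^esub> a z \<otimes>\<^bsub>A\<^esub> c) \<in>
           moves \<one>\<^bsub>H\<^esub> (2 * D + r0) \<union> rigid_colours s (2 * s + r0)"
proof (cases "\<exists>x\<in>Z. \<forall>y\<in>Z. d (h x) (h y) \<le> D")
  case True
  then obtain x where x: "x \<in> Z" "\<And>y. y \<in> Z \<Longrightarrow> d (h x) (h y) \<le> D" by blast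
  have "\<alpha> (inv\<^bsub>H\<^esub> h z) (inv\<^bsub>A\<^esub> a z \<otimes>\<^bsub>A\<^esub> a x) \<in> moves \<one>\<^bsub>H\<^esub> (2 * D + r0)" if z: "z \<in> Z" for z
  proof -
    obtain g where g: "path_between Z z x g" using conn z x by blast
    have "d (h z) (h y) \<le> 2 * D" if "y \<in> Z" for y
      using x(2)[OF that] x(2)[OF z] H.wd_triangle[of "h z" "h x" "h y"] H.wd_sym[of "h z" "h x"]
        h[OF x(1)] h[OF z] h[OF that] by linarith
    moreover have "0 \<le> 2 * D" using D s K r0 by simp
    ultimately have "inv\<^bsub>A\<^esub> a z \<otimes>\<^bsub>A\<^esub> a x \<in> moves (h z) (2 * D + r0)"
      using escape[OF g, of "2 * D"] by force
    then show ?thesis using \<alpha>_moves[of "h z" "inv\<^bsub>H\<^esub> h z"] z by fastforce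
  qed
  then show ?thesis using x(1) by (intro bexI[of _ "a x"]) auto
next
  case False
  have esc: "\<exists>w\<in>Z. E < d (h x) (h w) \<and> d (h x) (h w) \<le> E + r0 \<and>
                inv\<^bsub>A\<^esub> a x \<otimes>\<^bsub>A\<^esub> a w \<in> moves (h x) (E + r0)"
    if x: "x \<in> Z" and E: "0 \<le> E" "E \<le> D" for x E
  proof -
    obtain y where y: "y \<in> Z" "\<not> d (h x) (h y) \<le> D" using False x by blast
    obtain g where g: "path_between Z x y g" using conn x y by blast
    show ?thesis
    proof (rule ccontr)
      assume "\<not> ?thesis"
      then have "d (h x) (h y) \<le> E" using escape[OF g E(1)] by blast
      then show False using y E by simp
    qed
  qed
  define x where "x = x0"
  have x: "x \<in> Z" using ne x_def by simp
  obtain y where y: "y \<in> Z" "D < d (h x) (h y)" using False x by force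
  define \<Delta> where "\<Delta> = K + 2 * s"
  have \<Delta>: "0 \<le> \<Delta>" "\<Delta> \<le> D" using D s K r0 by (auto simp: \<Delta>_def)
  obtain w where w: "w \<in> Z" "\<Delta> < d (h x) (h w)" "d (h x) (h w) \<le> \<Delta> + r0"
    using esc[OF x \<Delta>] by blast
  have "d (h x) (h y) \<le> d (h x) (h w) + d (h w) (h y)"
    using x y w by (intro H.wd_triangle) auto
  then have wy: "\<Delta> < d (h w) (h y)" using y w D \<Delta>_def by simp
  have xy: "\<Delta> < d (h x) (h y)" using y \<Delta> by simp
  let ?X = "B (h x) s" and ?Y = "B (h y) s" and ?W = "B (h w) s"
  have sub: "?X \<subseteq> carrier H" "?Y \<subseteq> carrier H" "?W \<subseteq> carrier H" by (simp_all add: H.wball_subset)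
  have sd: "K \<le> d p q" if "u \<in> Z" "v \<in> Z" "\<Delta> < d (h u) (h v)" "p \<in> B (h u) s" "q \<in> B (h v) s" for u v p q
    using set_distance_wball[of "h u" "h v" K s p q] that by (simp add: \<Delta>_def)
  have "inv\<^bsub>A\<^esub> a x \<otimes>\<^bsub>A\<^esub> a y \<in> (L (?X \<union> ?W) <#>\<^bsub>A\<^esub> L (?W \<union> ?Y)) \<inter> L (?X \<union> ?Y)"
    using pair[OF x w(1)] pair[OF w(1) y(1)] pair[OF x y(1)] change_trans[OF x w(1) y(1), symmetric]
    unfolding set_mult_def by blast
  also have "\<dots> \<subseteq> L ?X <#>\<^bsub>A\<^esub> L ?Y"
  proof (rule full)
    show "set_distance d ?X ?W \<ge> ereal K" "set_distance d ?X ?Y \<ge> ereal K"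
      "set_distance d ?X (?W \<union> ?Y) \<ge> ereal K" "set_distance d ?W ?Y \<ge> ereal K"
      unfolding set_distance_def using sd[OF x w(1,2)] sd[OF x y(1) xy] sd[OF w(1) y(1) wy]
      by (auto intro!: INF_greatest)
  qed (use sub in auto)
  finally obtain l m where lm: "l \<in> L ?X" "m \<in> L ?Y" "inv\<^bsub>A\<^esub> a x \<otimes>\<^bsub>A\<^esub> a y = l \<otimes>\<^bsub>A\<^esub> m"
    unfolding set_mult_def by blast
  have lmA: "l \<in> carrier A" "m \<in> carrier A" using lm L_closed sub by auto
  define c where "c = a x \<otimes>\<^bsub>A\<^esub> l"
  have c: "c \<in> carrier A" unfolding c_def using x lmA by simp
  have "a y = c \<otimes>\<^bsub>A\<^esub> m"
  proof -
    have "a x \<otimes>\<^bsub>A\<^esub> (inv\<^bsub>A\<^esub> a x \<otimes>\<^bsub>A\<^esub> a y) = a y" using x y by (simp add: m_assoc[symmetric])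
    then show ?thesis unfolding lm(3) c_def using x lmA by (simp add: m_assoc)
  qed
  then have cy: "inv\<^bsub>A\<^esub> a y \<otimes>\<^bsub>A\<^esub> c = inv\<^bsub>A\<^esub> m"
    using c lmA by (simp add: inv_mult_group m_assoc)
  have cx: "inv\<^bsub>A\<^esub> a x \<otimes>\<^bsub>A\<^esub> c = l" unfolding c_def using x lmA by (simp add: m_assoc[symmetric])
  have disj: "?X \<inter> ?Y = {}"
  proof (rule ccontr)
    assume "?X \<inter> ?Y \<noteq> {}"
    then obtain u where u: "u \<in> carrier H" "d (h x) u \<le> s" "d (h y) u \<le> s"
      by (auto simp: H.wball_def)
    then show False
      using H.wd_triangle[of "h x" u "h y"] H.wd_sym[of "h y" u] x y xy K by (simp add: \<Delta>_def)
  qed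
  have cz: "inv\<^bsub>A\<^esub> a z \<otimes>\<^bsub>A\<^esub> c \<in> L (B (h z) s)" if z: "z \<in> Z" for z
  proof -
    have split: "inv\<^bsub>A\<^esub> a z \<otimes>\<^bsub>A\<^esub> c \<in> L (B (h z) s \<union> B (h v) s)"
      if v: "v \<in> Z" and e: "inv\<^bsub>A\<^esub> a v \<otimes>\<^bsub>A\<^esub> c \<in> L (B (h v) s)" for v
    proof -
      have sub: "B (h z) s \<union> B (h v) s \<subseteq> carrier H" using H.wball_subset by blast
      have "inv\<^bsub>A\<^esub> a v \<otimes>\<^bsub>A\<^esub> c \<in> L (B (h z) s \<union> B (h v) s)"
        using e L_mono[OF _ sub, of "B (h v) s"] by blast
      then have "(inv\<^bsub>A\<^esub> a z \<otimes>\<^bsub>A\<^esub> a v) \<otimes>\<^bsub>A\<^esub> (inv\<^bsub>A\<^esub> a v \<otimes>\<^bsub>A\<^esub> c) \<in> L (B (h z) s \<union> B (h v) s)"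
        using pair[OF z v] subgroup.m_closed[OF subgroup_L[OF sub]] by blast
      moreover have "(inv\<^bsub>A\<^esub> a z \<otimes>\<^bsub>A\<^esub> a v) \<otimes>\<^bsub>A\<^esub> (inv\<^bsub>A\<^esub> a v \<otimes>\<^bsub>A\<^esub> c) = inv\<^bsub>A\<^esub> a z \<otimes>\<^bsub>A\<^esub> c"
        using z v c by (metis a inv_closed inv_solve_left m_assoc m_closed)
      ultimately show ?thesis by simp
    qed
    have "inv\<^bsub>A\<^esub> m \<in> L ?Y" using subgroup.m_inv_closed[OF subgroup_L[OF sub(2)] lm(2)] .
    then have "inv\<^bsub>A\<^esub> a z \<otimes>\<^bsub>A\<^esub> c \<in> L (B (h z) s \<union> ?X) \<inter> L (B (h z) s \<union> ?Y)"
      using split[OF x] split[OF y(1)] lm(1) cx cy by simp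
    also have "\<dots> = L ((B (h z) s \<union> ?X) \<inter> (B (h z) s \<union> ?Y))"
      using sub H.wball_subset by (intro L_Int) auto
    also have "(B (h z) s \<union> ?X) \<inter> (B (h z) s \<union> ?Y) = B (h z) s" using disj by blast
    finally show ?thesis .
  qed
  have "\<alpha> (inv\<^bsub>H\<^esub> h z) (inv\<^bsub>A\<^esub> a z \<otimes>\<^bsub>A\<^esub> c) \<in> rigid_colours s (2 * s + r0)" if z: "z \<in> Z" for z
  proof -
    have "2 * s \<le> D" using D s K r0 by simp
    then obtain v where "v \<in> Z" "2 * s < d (h z) (h v)" "d (h z) (h v) \<le> 2 * s + r0"
        "inv\<^bsub>A\<^esub> a z \<otimes>\<^bsub>A\<^esub> a v \<in> moves (h z) (2 * s + r0)"
      using esc[OF z, of "2 * s"] s by auto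
    then show ?thesis using colour_in_rigid_colours[OF s z _ c] cz z by blast
  qed
  then show ?thesis using c by blast
qed

end

section \<open>Coarse embeddings of spaces with thick bigons\<close>

lemma coarse_parameters_bound:
  assumes "coarse_parameters \<sigma>\<^sub>1 \<sigma>\<^sub>2" "0 \<le> t"
  obtains b where "0 \<le> b" "\<And>u. 0 \<le> u \<Longrightarrow> u \<le> t \<Longrightarrow> \<sigma>\<^sub>2 u \<le> b"
proof -
  have "bdd_above (\<sigma>\<^sub>2 ` {0..t})" "0 \<le> \<sigma>\<^sub>2 0"
    using assms unfolding coarse_parameters_def by auto
  then obtain b where b: "\<forall>y\<in>\<sigma>\<^sub>2 ` {0..t}. y \<le> b" unfolding bdd_above_def by blast
  have "\<sigma>\<^sub>2 0 \<in> \<sigma>\<^sub>2 ` {0..t}" using assms(2) by simp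
  then have "0 \<le> b" using b \<open>0 \<le> \<sigma>\<^sub>2 0\<close> by (meson order_trans)
  then show thesis using that[of b] b by simp
qed

text \<open>Only the order in which the constants are chosen is left; none of them may depend on \<open>\<rho>\<close>.
  \<open>r0\<close> and \<open>r1\<close> control moves between points at distance at most \<open>C + 1\<close> and come from \<open>\<sigma>\<^sub>2\<close> and
  the generators. They determine the size of the set of points with a common label, hence
  \<open>R\<close> through \<open>\<sigma>\<^sub>1\<close>. The thick bigon property turns \<open>R\<close> into \<open>M\<close>, and \<open>\<sigma>\<^sub>2\<close> turns \<open>M\<close> into the radius
  \<open>s\<close> of the supports at the endpoints. With the constant \<open>K\<close> of fullness this fixes the finite
  set \<open>E\<close> of colours by which points deviate from the coset.\<close>
theorem theorem4p17:
  fixes Z :: "'z::metric_space set"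
    and H :: "('h, 'm) monoid_scheme"
    and A :: "('a, 'n) monoid_scheme"
    and L :: "'h set \<Rightarrow> 'a set"
    and \<alpha> :: "'h \<Rightarrow> 'a \<Rightarrow> 'a"
    and S :: "('a \<times> 'h) set"
    and T :: "'h set"
  defines "LH \<equiv> semidirect_product A H \<alpha>"
  assumes "geodesic_space Z"
    and "thick_bigon_property Z"
    and "halo_product_data H A L \<alpha>"
    and "finite_generating_set LH S"
    and "finite_generating_set H T"
    and "full_halo (carrier H) (word_metric H T) A L"
    and "locally_finite_group A"
  shows "\<forall>\<sigma>\<^sub>1 \<sigma>\<^sub>2. coarse_parameters \<sigma>\<^sub>1 \<sigma>\<^sub>2 \<longrightarrow>
     (\<exists>D\<ge>0. \<forall>\<rho>. coarse_embedding \<sigma>\<^sub>1 \<sigma>\<^sub>2 Z (carrier LH) (word_metric LH S) \<rho> \<longrightarrow>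
        (\<exists>c\<in>carrier A.
           \<rho> ` Z \<subseteq> neighbourhood (carrier LH) (word_metric LH S)
                     ((c, \<one>\<^bsub>H\<^esub>) <#\<^bsub>LH\<^esub> ({\<one>\<^bsub>A\<^esub>} \<times> carrier H)) D))"
proof (intro allI impI)
  fix \<sigma>\<^sub>1 \<sigma>\<^sub>2 :: "real \<Rightarrow> real" assume \<sigma>: "coarse_parameters \<sigma>\<^sub>1 \<sigma>\<^sub>2"
  interpret G: halo_product_data H A L \<alpha> by fact
  interpret G: fg_halo_product H A L \<alpha> T S
    using assms G.H.group_axioms G.halo_product_data_axioms
    unfolding fg_halo_product_def fg_halo_product_axioms_def fg_group_def fg_group_axioms_def LH_def
    by simp
  let ?d = "word_metric H T" and ?D = "word_metric LH S"
  obtain \<kappa> where \<kappa>: "0 \<le> \<kappa>"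
    "\<And>a h b k. (a, h) \<in> carrier LH \<Longrightarrow> (b, k) \<in> carrier LH \<Longrightarrow>
       ?d h k \<le> \<kappa> * ?D (a, h) (b, k) \<and> inv\<^bsub>A\<^esub> a \<otimes>\<^bsub>A\<^esub> b \<in> G.moves h (\<kappa> * ?D (a, h) (b, k))"
    using G.displacement unfolding LH_def by metis
  obtain m where m: "0 \<le> m" "\<And>h r. h \<in> carrier H \<Longrightarrow> G.moves h r \<subseteq> L (G.H.wball h (r + m))"
    using G.moves_support by metis
  obtain C where C: "0 \<le> C"
    and thick: "\<And>R. 0 \<le> R \<Longrightarrow> \<exists>M\<ge>0. \<forall>x\<in>Z. \<forall>y\<in>Z. \<exists>g1. path_between Z x y g1 \<and>
        (\<forall>p\<in>path_image g1. dist x p \<ge> M \<and> dist y p \<ge> M \<longrightarrow>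
           (\<exists>g2. path_between Z x y g2 \<and> coarsely_homotopic Z C g1 g2 \<and>
                 path_image g2 \<inter> cball p R = {}))"
    using assms(3) unfolding thick_bigon_property_def by blast
  obtain b0 where b0: "0 \<le> b0" "\<And>u. 0 \<le> u \<Longrightarrow> u \<le> C + 1 \<Longrightarrow> \<sigma>\<^sub>2 u \<le> b0"
    using coarse_parameters_bound[OF \<sigma>, of "C + 1"] C by (metis add_nonneg_nonneg zero_le_one)
  define r0 where "r0 = \<kappa> * b0"
  define r1 where "r1 = r0 + m"
  have r0: "0 \<le> r0" "r0 \<le> r1" using \<kappa>(1) b0(1) m(1) by (auto simp: r0_def r1_def)
  have "finite (G.moves \<one>\<^bsub>H\<^esub> (r0 + 2 * r1))" by (simp add: G.finite_moves)
  then obtain w where w: "\<And>a h b k. a \<in> carrier A \<Longrightarrow> h \<in> carrier H \<Longrightarrow> b \<in> carrier A \<Longrightarrow> k \<in> carrier H \<Longrightarrow>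
       \<alpha> (inv\<^bsub>H\<^esub> h) (inv\<^bsub>A\<^esub> a \<otimes>\<^bsub>A\<^esub> b) \<in> G.moves \<one>\<^bsub>H\<^esub> (r0 + 2 * r1) \<Longrightarrow> ?d h k \<le> 2 * r1 \<Longrightarrow> ?D (a, h) (b, k) \<le> w"
    using G.bounded_distance[where r = "2 * r1"] unfolding LH_def by metis
  have "eventually (\<lambda>t. w < \<sigma>\<^sub>1 t) at_top"
    using \<sigma> unfolding coarse_parameters_def by (auto simp: filterlim_at_top_dense)
  then obtain R0 where R0: "\<And>t. R0 \<le> t \<Longrightarrow> w < \<sigma>\<^sub>1 t" unfolding eventually_at_top_linorder by blast
  define R where "R = max R0 0"
  have R: "0 \<le> R" by (simp add: R_def)
  have le_R: "t \<le> R" if "\<sigma>\<^sub>1 t \<le> w" for t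
    using R0[of t] that unfolding R_def by linarith
  obtain M where M: "0 \<le> M" and bigon: "\<And>x y. x \<in> Z \<Longrightarrow> y \<in> Z \<Longrightarrow> \<exists>g1. path_between Z x y g1 \<and>
        (\<forall>p\<in>path_image g1. dist x p \<ge> M \<and> dist y p \<ge> M \<longrightarrow>
           (\<exists>g2. path_between Z x y g2 \<and> coarsely_homotopic Z C g1 g2 \<and>
                 path_image g2 \<inter> cball p R = {}))"
    using thick[OF R] by blast
  obtain b1 where b1: "0 \<le> b1" "\<And>u. 0 \<le> u \<Longrightarrow> u \<le> M \<Longrightarrow> \<sigma>\<^sub>2 u \<le> b1"
    using coarse_parameters_bound[OF \<sigma> M] by metis
  define r2 where "r2 = \<kappa> * b1"
  define s where "s = r1 + r2"
  have r2: "0 \<le> r2" "0 \<le> s" using \<kappa>(1) b1(1) r0 by (auto simp: r2_def s_def)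
  obtain K where K: "0 \<le> K"
    and full: "\<And>P Q R U. P \<subseteq> carrier H \<Longrightarrow> Q \<subseteq> carrier H \<Longrightarrow> R \<subseteq> carrier H \<Longrightarrow> U \<subseteq> carrier H \<Longrightarrow>
        set_distance ?d P Q \<ge> ereal K \<Longrightarrow> set_distance ?d P R \<ge> ereal K \<Longrightarrow>
        set_distance ?d P U \<ge> ereal K \<Longrightarrow> set_distance ?d Q R \<ge> ereal K \<Longrightarrow>
        (L (P \<union> Q) <#>\<^bsub>A\<^esub> L U) \<inter> L (P \<union> R) \<subseteq> L P <#>\<^bsub>A\<^esub> L R"
    using assms(7) unfolding full_halo_def by meson
  define D1 where "D1 = 2 * (K + 2 * s) + r0"
  define E where "E = G.moves \<one>\<^bsub>H\<^esub> (2 * D1 + r0) \<union> G.rigid_colours s (2 * s + r0)"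
  have "finite E" unfolding E_def by (simp add: G.finite_moves G.finite_rigid_colours)
  then obtain D where D: "\<And>a h b k. a \<in> carrier A \<Longrightarrow> h \<in> carrier H \<Longrightarrow> b \<in> carrier A \<Longrightarrow> k \<in> carrier H \<Longrightarrow>
       \<alpha> (inv\<^bsub>H\<^esub> h) (inv\<^bsub>A\<^esub> a \<otimes>\<^bsub>A\<^esub> b) \<in> E \<Longrightarrow> ?d h k \<le> 0 \<Longrightarrow> ?D (a, h) (b, k) \<le> D"
    using G.bounded_distance[where r = 0] unfolding LH_def by metis
  show "\<exists>D\<ge>0. \<forall>\<rho>. coarse_embedding \<sigma>\<^sub>1 \<sigma>\<^sub>2 Z (carrier LH) ?D \<rho> \<longrightarrow>
        (\<exists>c\<in>carrier A. \<rho> ` Z \<subseteq> neighbourhood (carrier LH) ?D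
                     ((c, \<one>\<^bsub>H\<^esub>) <#\<^bsub>LH\<^esub> ({\<one>\<^bsub>A\<^esub>} \<times> carrier H)) D)"
  proof (intro exI[of _ "max D 0"] conjI allI impI)
    fix \<rho> :: "'z \<Rightarrow> 'a \<times> 'h" assume emb: "coarse_embedding \<sigma>\<^sub>1 \<sigma>\<^sub>2 Z (carrier LH) ?D \<rho>"
    define a h where "a z = fst (\<rho> z)" and "h z = snd (\<rho> z)" for z
    have \<rho>: "\<rho> z = (a z, h z)" for z by (simp add: a_def h_def)
    have \<rho>LH: "(a z, h z) \<in> carrier LH" if "z \<in> Z" for z
      using emb that unfolding coarse_embedding_def \<rho>[symmetric] by blast
    have ah: "a z \<in> carrier A" "h z \<in> carrier H" if "z \<in> Z" for z
      using \<rho>LH[OF that] by (auto simp: LH_def G.LH_simps)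
    have \<sigma>\<rho>: "\<sigma>\<^sub>1 (dist x y) \<le> ?D (a x, h x) (a y, h y)" "?D (a x, h x) (a y, h y) \<le> \<sigma>\<^sub>2 (dist x y)"
      if "x \<in> Z" "y \<in> Z" for x y
      using emb that unfolding coarse_embedding_def \<rho>[symmetric] by blast+
    have move: "?d (h z) (h z') \<le> \<kappa> * b \<and> inv\<^bsub>A\<^esub> a z \<otimes>\<^bsub>A\<^esub> a z' \<in> G.moves (h z) (\<kappa> * b)"
      if "z \<in> Z" "z' \<in> Z" "\<sigma>\<^sub>2 (dist z z') \<le> b" for z z' b
    proof -
      have *: "\<kappa> * ?D (a z, h z) (a z', h z') \<le> \<kappa> * b"
        using \<sigma>\<rho>[OF that(1,2)] that(3) \<kappa>(1) by (intro mult_left_mono) auto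
      then have "G.moves (h z) (\<kappa> * ?D (a z, h z) (a z', h z')) \<subseteq> G.moves (h z) (\<kappa> * b)"
        using ah[OF that(1)] by (intro G.moves_mono) (auto simp: G.H.wd_self)
      then show ?thesis using \<kappa>(2)[OF \<rho>LH[OF that(1)] \<rho>LH[OF that(2)]] * by auto
    qed
    \<comment> \<open>the threshold is \<open>C + 1\<close> because it must be positive and at least \<open>C\<close>\<close>
    interpret M: coarse_map H A L \<alpha> T S Z a h "C + 1" r0
    proof (unfold_locales)
      fix z z' assume "z \<in> Z" "z' \<in> Z" "dist z z' \<le> C + 1"
      then show "?d (h z) (h z') \<le> r0 \<and> inv\<^bsub>A\<^esub> a z \<otimes>\<^bsub>A\<^esub> a z' \<in> G.moves (h z) r0"
        unfolding r0_def by (intro move b0) auto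
    qed (use C r0 ah in auto)
    have pair: "inv\<^bsub>A\<^esub> a x \<otimes>\<^bsub>A\<^esub> a y \<in> L (G.H.wball (h x) s \<union> G.H.wball (h y) s)"
      if xy: "x \<in> Z" "y \<in> Z" for x y
    proof -
      obtain g where g: "path_between Z x y g"
        "\<And>p. p \<in> path_image g \<Longrightarrow> dist x p \<ge> M \<Longrightarrow> dist y p \<ge> M \<Longrightarrow>
           \<exists>g2. path_between Z x y g2 \<and> coarsely_homotopic Z C g g2 \<and> path_image g2 \<inter> cball p R = {}"
        using bigon[OF xy] by blast
      show ?thesis
        unfolding s_def
      proof (rule M.change_supported_near_ends[OF _ xy _ r0(2) _ _ r2(1) g])
        show "G.moves k r0 \<subseteq> L (G.H.wball k r1)" if "k \<in> carrier H" for k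
          using m(2)[OF that] by (simp add: r1_def)
        show "?d (h z) (h z') \<le> r2" if "z \<in> Z" "z' \<in> Z" "dist z z' \<le> M" for z z'
          using move[OF that(1,2) b1(2)] that(3) by (simp add: r2_def)
        fix p p' q assume p: "p \<in> Z" "p' \<in> Z" "q \<in> carrier H" "?d q (h p) \<le> r1" "?d q (h p') \<le> r1"
          and ch: "inv\<^bsub>A\<^esub> a p \<otimes>\<^bsub>A\<^esub> a p' \<in> G.moves q (r0 + r1)"
        note hp = ah(2)[OF p(1)] ah(2)[OF p(2)]
        have "G.moves q (r0 + r1) \<subseteq> G.moves (h p) (r0 + 2 * r1)"
          using p hp G.H.wd_sym[of "h p" q] by (intro G.moves_mono) auto
        then have "\<alpha> (inv\<^bsub>H\<^esub> h p) (inv\<^bsub>A\<^esub> a p \<otimes>\<^bsub>A\<^esub> a p') \<in> G.moves \<one>\<^bsub>H\<^esub> (r0 + 2 * r1)"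
          using G.\<alpha>_moves[of "h p" "inv\<^bsub>H\<^esub> h p"] hp ch by fastforce
        moreover have "?d (h p) (h p') \<le> 2 * r1"
          using G.H.wd_triangle[of "h p" q "h p'"] G.H.wd_sym[of "h p" q] p hp by simp
        ultimately have "?D (a p, h p) (a p', h p') \<le> w" using ah p by (intro w) auto
        then show "dist p p' \<le> R" using \<sigma>\<rho>(1)[OF p(1,2)] by (intro le_R) simp
      qed auto
    qed
    show "\<exists>c\<in>carrier A. \<rho> ` Z \<subseteq> neighbourhood (carrier LH) ?D
                     ((c, \<one>\<^bsub>H\<^esub>) <#\<^bsub>LH\<^esub> ({\<one>\<^bsub>A\<^esub>} \<times> carrier H)) (max D 0)"
    proof (cases "Z = {}")
      case True
      then show ?thesis by (intro bexI[of _ "\<one>\<^bsub>A\<^esub>"]) auto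
    next
      case False
      then obtain x0 where x0: "x0 \<in> Z" by blast
      have conn: "\<exists>g. path_between Z x y g" if "x \<in> Z" "y \<in> Z" for x y
        using bigon[OF that] by blast
      have "\<exists>c\<in>carrier A. \<forall>z\<in>Z. \<alpha> (inv\<^bsub>H\<^esub> h z) (inv\<^bsub>A\<^esub> a z \<otimes>\<^bsub>A\<^esub> c) \<in> E"
        unfolding E_def by (rule M.common_coset[OF x0 conn r2(2) K D1_def pair full])
      then obtain c where c: "c \<in> carrier A" "\<And>z. z \<in> Z \<Longrightarrow> \<alpha> (inv\<^bsub>H\<^esub> h z) (inv\<^bsub>A\<^esub> a z \<otimes>\<^bsub>A\<^esub> c) \<in> E"
        by blast
      have "\<rho> z \<in> neighbourhood (carrier LH) ?D
                     ((c, \<one>\<^bsub>H\<^esub>) <#\<^bsub>LH\<^esub> ({\<one>\<^bsub>A\<^esub>} \<times> carrier H)) (max D 0)" if z: "z \<in> Z" for z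
      proof -
        have "(c, h z) = (c, \<one>\<^bsub>H\<^esub>) \<otimes>\<^bsub>LH\<^esub> (\<one>\<^bsub>A\<^esub>, h z)"
          using c ah[OF z] by (simp add: LH_def G.LH_simps G.\<alpha>_one)
        then have "(c, h z) \<in> (c, \<one>\<^bsub>H\<^esub>) <#\<^bsub>LH\<^esub> ({\<one>\<^bsub>A\<^esub>} \<times> carrier H)"
          using ah[OF z] unfolding l_coset_def by auto
        moreover have "?D (\<rho> z) (c, h z) \<le> max D 0"
          using D[OF ah[OF z] c(1) ah(2)[OF z] c(2)[OF z]] ah[OF z] by (simp add: \<rho> G.H.wd_self)
        ultimately show ?thesis unfolding neighbourhood_def using \<rho>LH[OF z] \<rho> by auto
      qed
      then show ?thesis using c(1) by blast
    qed
  qed simp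
qed

end
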